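(* Let $n\to\infty$, $\Delta=\Delta_n\to0$, $n\Delta\to\infty$, let $r\in(0,1)$ and suppose $n\Delta^{2-r}=o(1)$. Let $\sigma>0$ be the coefficient of the Brownian component of $(L_t)$. Then $$\sqrt n\big(\hat\sigma_n^{(r)}-\sigma^r\big)\ \text{converges in distribution to}\ \mathcal{N}\Big(0,\sigma^{2r}\Big(\frac{m_{2r}}{m_r^2}-1\Big)\Big)$$ in each of the following cases: (i) $(L_t)$ is a Lévy process with Lévy density $n(\cdot)$ satisfying $\int x^2n(x)\,dx<\infty$, $\int|x|n(x)\,dx<\infty$ and $\int|x|^rn(x)\,dx<\infty$; (ii) $L_t=bt+\sigma W_t+X_t$ with $X_t=B_{\Gamma_t}$, where $W,B,\Gamma$ are independent processes, $W,B$ are standard Brownian motions, and $\Gamma$ is a subordinator with Lévy density $n_\Gamma$ satisfying $\mathbb{E}\Gamma_1=\int_0^{+\infty}\gamma n_\Gamma(\gamma)\,d\gamma<\infty$ and $\int_0^{+\infty}\gamma^{r/2}n_\Gamma(\gamma)\,d\gamma<\infty$. Consequently, in these cases, $\sqrt n(\hat\sigma(r)-\sigma)$ converges in distribution to $\mathcal{N}\big(0,\frac{\sigma^2}{r^2}\big(\frac{m_{2r}}{m_r^2}-1\big)\big)$.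
   Context: When $\int x^2n(x)\,dx<\infty$, a Lévy process $(L_t)$ with Lévy density $n(\cdot)$ has characteristic function $\mathbb{E}(e^{iuL_t})=\exp\{t(iub-\frac12u^2\sigma^2+\int_{\mathbb{R}}(e^{iux}-1-iux)n(x)\,dx)\}$ with $b=\mathbb{E}L_1$; $\sigma$ is the coefficient of its Brownian component. Observations: $Z_k=L_{k\Delta}-L_{(k-1)\Delta}$, $1\le k\le n$. Let $m_r=\mathbb{E}|X|^r$ for $X$ a standard Gaussian variable. The power variation estimators are $\hat\sigma_n^{(r)}=\frac{1}{m_rn\Delta^{r/2}}\sum_{k=1}^n|Z_k|^r$ and $\hat\sigma(r)=[\hat\sigma_n^{(r)}]^{1/r}$. *)

theory Defs
  imports "HOL-Probability.Probability"
begin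

text \<open>
  Processes are families \<open>X :: real \<Rightarrow> 'a \<Rightarrow> real\<close> of random variables on a probability space \<open>M\<close>;
  only the times \<open>t \<ge> 0\<close> are ever used. Path properties are required almost surely.
\<close>

definition real_process :: "'a measure \<Rightarrow> (real \<Rightarrow> 'a \<Rightarrow> real) \<Rightarrow> bool" where
  "real_process M X \<longleftrightarrow> (\<forall>t\<ge>0. X t \<in> borel_measurable M)"

definition independent_increments :: "'a measure \<Rightarrow> (real \<Rightarrow> 'a \<Rightarrow> real) \<Rightarrow> bool" where
  "independent_increments M X \<longleftrightarrow>
     (\<forall>(t :: nat \<Rightarrow> real) m. 0 \<le> t 0 \<and> (\<forall>i<m. t i \<le> t (Suc i)) \<longrightarrow>
        prob_space.indep_vars M (\<lambda>_. borel) (\<lambda>i \<omega>. X (t (Suc i)) \<omega> - X (t i) \<omega>) {..<m})"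

definition stationary_increments :: "'a measure \<Rightarrow> (real \<Rightarrow> 'a \<Rightarrow> real) \<Rightarrow> bool" where
  "stationary_increments M X \<longleftrightarrow>
     (\<forall>s\<ge>0. \<forall>t\<ge>0. distr M borel (\<lambda>\<omega>. X (s + t) \<omega> - X s \<omega>) = distr M borel (\<lambda>\<omega>. X t \<omega> - X 0 \<omega>))"

definition cadlag :: "(real \<Rightarrow> real) \<Rightarrow> bool" where
  "cadlag f \<longleftrightarrow>
     (\<forall>t\<ge>0. continuous (at_right t) f) \<and> (\<forall>t>0. \<exists>l. (f \<longlongrightarrow> l) (at_left t))"

definition levy_process :: "'a measure \<Rightarrow> (real \<Rightarrow> 'a \<Rightarrow> real) \<Rightarrow> bool" where
  "levy_process M X \<longleftrightarrow>
     real_process M X \<and> (AE \<omega> in M. X 0 \<omega> = 0) \<and>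
     independent_increments M X \<and> stationary_increments M X \<and>
     (AE \<omega> in M. cadlag (\<lambda>t. X t \<omega>))"

text \<open>
  A Levy process with Brownian coefficient \<open>\<sigma>\<close> and Levy density \<open>\<nu>\<close> satisfying
  \<open>\<integral> x\<^sup>2 \<nu>(x) dx < \<infinity>\<close>. Under this moment condition no truncation is needed in the
  Levy-Khintchine formula, and the drift parameter is the mean of \<open>L\<^sub>1\<close>.
\<close>

definition levy_process_with_density ::
  "'a measure \<Rightarrow> (real \<Rightarrow> 'a \<Rightarrow> real) \<Rightarrow> real \<Rightarrow> (real \<Rightarrow> real) \<Rightarrow> bool" where
  "levy_process_with_density M L \<sigma> \<nu> \<longleftrightarrow>
     levy_process M L \<and>
     \<nu> \<in> borel_measurable borel \<and> (\<forall>x. 0 \<le> \<nu> x) \<and> integrable lborel (\<lambda>x. x\<^sup>2 * \<nu> x) \<and>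
     integrable M (L 1) \<and>
     (\<forall>t\<ge>0. \<forall>u.
        char (distr M borel (L t)) u =
          exp (complex_of_real t *
            (\<i> * complex_of_real u * complex_of_real (integral\<^sup>L M (L 1))
             - complex_of_real (u\<^sup>2 * \<sigma>\<^sup>2 / 2)
             + (CLINT x|lborel. (iexp (u * x) - 1 - \<i> * complex_of_real (u * x)) * complex_of_real (\<nu> x)))))"

text \<open>
  A subordinator: a Levy process with nondecreasing paths. Its Levy measure is carried by
  \<open>(0, \<infinity>)\<close> and integrates \<open>min 1 \<gamma>\<close>; the number \<open>c\<close> is its (deterministic, nonnegative) drift.
  Only the values of \<open>\<nu>\<close> on \<open>(0, \<infinity>)\<close> matter.
\<close>

definition subordinator_with_density ::
  "'a measure \<Rightarrow> (real \<Rightarrow> 'a \<Rightarrow> real) \<Rightarrow> (real \<Rightarrow> real) \<Rightarrow> bool" where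
  "subordinator_with_density M \<Gamma> \<nu> \<longleftrightarrow>
     levy_process M \<Gamma> \<and> (AE \<omega> in M. mono_on {0..} (\<lambda>t. \<Gamma> t \<omega>)) \<and>
     set_borel_measurable borel {0<..} \<nu> \<and> (\<forall>\<gamma>>0. 0 \<le> \<nu> \<gamma>) \<and>
     set_integrable lborel {0<..} (\<lambda>\<gamma>. min 1 \<gamma> * \<nu> \<gamma>) \<and>
     (\<exists>c\<ge>0. \<forall>t\<ge>0. \<forall>u.
        char (distr M borel (\<Gamma> t)) u =
          exp (complex_of_real t *
            (\<i> * complex_of_real (u * c)
             + (CLINT \<gamma>:{0<..}|lborel. (iexp (u * \<gamma>) - 1) * complex_of_real (\<nu> \<gamma>)))))"

text \<open>The normal law with mean \<open>\<mu>\<close> and variance \<open>v > 0\<close> (the second parameter of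
  \<^const>\<open>normal_density\<close> is the standard deviation).\<close>

definition normal_law :: "real \<Rightarrow> real \<Rightarrow> real measure" where
  "normal_law \<mu> v = density lborel (\<lambda>x. ennreal (normal_density \<mu> (sqrt v) x))"

definition standard_brownian_motion :: "'a measure \<Rightarrow> (real \<Rightarrow> 'a \<Rightarrow> real) \<Rightarrow> bool" where
  "standard_brownian_motion M W \<longleftrightarrow>
     real_process M W \<and> (AE \<omega> in M. W 0 \<omega> = 0) \<and>
     independent_increments M W \<and>
     (\<forall>s t. 0 \<le> s \<and> s < t \<longrightarrow> distr M borel (\<lambda>\<omega>. W t \<omega> - W s \<omega>) = normal_law 0 (t - s)) \<and>
     (AE \<omega> in M. continuous_on {0..} (\<lambda>t. W t \<omega>))"

text \<open>Mutual independence of three processes, each viewed as a random element of the product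
  space \<open>\<real>\<close> to the power \<open>[0, \<infinity>)\<close>.\<close>

definition independent_processes3 ::
  "'a measure \<Rightarrow> (real \<Rightarrow> 'a \<Rightarrow> real) \<Rightarrow> (real \<Rightarrow> 'a \<Rightarrow> real) \<Rightarrow> (real \<Rightarrow> 'a \<Rightarrow> real) \<Rightarrow> bool" where
  "independent_processes3 M X Y Z \<longleftrightarrow>
     prob_space.indep_vars M (\<lambda>_. \<Pi>\<^sub>M t\<in>{0..}. borel)
       (\<lambda>i \<omega>. \<lambda>t\<in>{0..}. ([X, Y, Z] ! i) t \<omega>) {..<3::nat}"

definition gauss_abs_moment :: "real \<Rightarrow> real" where
  "gauss_abs_moment r = (LINT x|std_normal_distribution. \<bar>x\<bar> powr r)"

definition power_variation_estimator ::
  "(real \<Rightarrow> 'a \<Rightarrow> real) \<Rightarrow> real \<Rightarrow> real \<Rightarrow> nat \<Rightarrow> 'a \<Rightarrow> real" where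
  "power_variation_estimator L \<Delta> r n \<omega> =
     1 / (gauss_abs_moment r * real n * \<Delta> powr (r / 2)) *
     (\<Sum>k=1..n. \<bar>L (real k * \<Delta>) \<omega> - L ((real k - 1) * \<Delta>) \<omega>\<bar> powr r)"

definition sigma_estimator ::
  "(real \<Rightarrow> 'a \<Rightarrow> real) \<Rightarrow> real \<Rightarrow> real \<Rightarrow> nat \<Rightarrow> 'a \<Rightarrow> real" where
  "sigma_estimator L \<Delta> r n \<omega> = power_variation_estimator L \<Delta> r n \<omega> powr (1 / r)"

end

theory Submission
  imports Defs
begin

text \<open>
  An increment of \<open>L\<close> over a step \<open>\<Delta>\<close> is a Gaussian variable with variance \<open>\<sigma>\<^sup>2 \<Delta>\<close>, plus a
  deterministic drift of order \<open>\<Delta>\<close>, plus a jump part. If only the centred Gaussian variable were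
  present, the power variation estimator would be an average of independent copies of
  \<open>\<sigma>\<^sup>r |N|\<^sup>r / m\<^sub>r\<close> with \<open>N\<close> standard normal, and the theorem would be the classical central limit
  theorem. Everything else is to show that the drift and the jumps are negligible at the scale
  \<open>1 / \<surd>n\<close>. All convergence statements are made for characteristic functions, where errors in the
  \<open>n\<close> factors simply add up.

  The jumps: since \<open>r \<le> 1\<close>, adding a jump part \<open>J\<close> changes the \<open>r\<close>-th power of an increment by at
  most \<open>|J|\<^sup>r\<close>, and \<open>E |J|\<^sup>r\<close> is at most \<open>\<Delta>\<close> times a constant given by the jump measure. After
  normalisation by \<open>\<Delta>\<^sup>r\<^sup>/\<^sup>2\<close> and summation of \<open>n\<close> terms divided by \<open>\<surd>n\<close> this is
  \<open>O(\<surd>n \<Delta>\<^sup>1\<^sup>-\<^sup>r\<^sup>/\<^sup>2)\<close>, which tends to 0 exactly because \<open>n \<Delta>\<^sup>2\<^sup>-\<^sup>r\<close> does. For a Levy process given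
  only by its characteristic function, the bound is derived in \<open>integral_diff_le_jumps\<close> by
  approximating the jump part with random walks whose steps are rare large jumps. The same lemma
  yields fractional moments of a subordinator (\<open>pure_jump_fractional_moment\<close>), and conditioning on
  the clock transfers them to subordinated Brownian motion
  (\<open>subordinated_brownian_increment_moment\<close>).

  The drift: the same crude estimate would not suffice, because the drift contributes
  \<open>\<Delta>\<^sup>r\<close> rather than \<open>\<Delta>\<close>. But the function \<open>|x|\<^sup>r\<close> is even, so a Gaussian law feels a small
  drift only to second order (\<open>even_gaussian_shift\<close>), and the total effect is \<open>O(\<surd>n \<Delta>)\<close>.

  The statement for the estimator of \<open>\<sigma>\<close> itself follows by the delta method with the function
  \<open>x\<^sup>1\<^sup>/\<^sup>r\<close>.
\<close>

section \<open>Fractional powers\<close>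

text \<open>
  Subadditivity of \<open>x\<^sup>p\<close> for \<open>p \<le> 1\<close>: with \<open>s = x + y\<close>, the fractions \<open>x / s\<close> and \<open>y / s\<close>
  lie in \<open>[0, 1]\<close>, where the power \<open>p\<close> only increases them, and they add up to 1.
\<close>
lemma powr_add_le_add_powr:
  fixes x y p :: real
  assumes "0 \<le> x" "0 \<le> y" "0 < p" "p \<le> 1"
  shows "(x + y) powr p \<le> x powr p + y powr p"
proof (cases "x + y = 0")
  case True
  then show ?thesis using assms by simp
next
  case False
  define s where "s = x + y"
  have s: "0 < s" using False assms by (simp add: s_def)
  have *: "z \<le> s powr (1 - p) * z powr p" if "0 \<le> z" "z \<le> s" for z
  proof -
    have "(z / s) powr 1 \<le> (z / s) powr p"
      using that s assms by (intro powr_mono') auto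
    then show ?thesis
      using that s by (auto simp: powr_divide powr_diff field_simps)
  qed
  have "s \<le> s powr (1 - p) * (x powr p + y powr p)"
    using *[of x] *[of y] assms by (simp add: s_def algebra_simps)
  then have "s * s powr p \<le> s * (x powr p + y powr p)"
    using s by (simp add: powr_diff field_simps)
  then show ?thesis
    using s by (simp only: mult_le_cancel_left_pos s_def[symmetric])
qed

text \<open>
  For \<open>p \<le> 1\<close> a jump changes the \<open>p\<close>-th power of an increment by at most the \<open>p\<close>-th power of its
  own size, whatever the Gaussian part of the increment is.
\<close>
lemma abs_powr_diff_le:
  fixes x y p :: real
  assumes "0 < p" "p \<le> 1"
  shows "\<bar>\<bar>x\<bar> powr p - \<bar>y\<bar> powr p\<bar> \<le> \<bar>x - y\<bar> powr p"
proof -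
  have "\<bar>a\<bar> powr p \<le> \<bar>b\<bar> powr p + \<bar>a - b\<bar> powr p" for a b :: real
  proof -
    have "\<bar>a\<bar> powr p \<le> (\<bar>b\<bar> + \<bar>a - b\<bar>) powr p"
      using assms by (intro powr_mono2) auto
    also have "\<dots> \<le> \<bar>b\<bar> powr p + \<bar>a - b\<bar> powr p"
      using assms by (intro powr_add_le_add_powr) auto
    finally show ?thesis .
  qed
  from this[of x y] this[of y x] show ?thesis by (simp add: abs_minus_commute abs_le_iff)
qed

lemma min_1_le_powr:
  fixes x p :: real
  assumes "0 < p" "p \<le> 1" "0 \<le> x"
  shows "min 1 x \<le> x powr p"
proof (cases "x \<le> 1")
  case True
  then show ?thesis using assms powr_mono'[of p 1 x] by (simp add: powr_one)
next
  case False
  then show ?thesis using assms by (simp add: ge_one_powr_ge_zero min_def)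
qed

lemma isCont_abs_powr:
  fixes x p :: real
  assumes "0 < p"
  shows "isCont (\<lambda>x. \<bar>x\<bar> powr p) x"
  unfolding isCont_def using assms by (intro tendsto_powr' tendsto_intros) auto

section \<open>Perturbation of a law by infinitely many small jumps\<close>

lemma cmod_iexp_diff_le: "cmod (iexp x - iexp y) \<le> \<bar>x - y\<bar>"
proof -
  have "iexp x - iexp y = iexp y * (iexp (x - y) - 1)"
    by (simp add: exp_diff right_diff_distrib)
  then show ?thesis
    using iexp_approx1[of "x - y" 0] by (simp add: norm_mult)
qed

lemma real_distribution_convolution:
  assumes "real_distribution N" "real_distribution \<mu>"
  shows "real_distribution (N \<star> \<mu>)"
proof -
  interpret N: real_distribution N by fact
  interpret \<mu>: real_distribution \<mu> by fact
  interpret P: pair_prob_space N \<mu> ..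
  show ?thesis
    unfolding convolution_def by (rule P.real_distribution_distr) (simp add: split_beta')
qed

lemma char_convolution:
  assumes "real_distribution N" "real_distribution \<mu>"
  shows "char (N \<star> \<mu>) u = char N u * char \<mu> u"
proof -
  interpret N: real_distribution N by fact
  interpret \<mu>: real_distribution \<mu> by fact
  interpret P: pair_prob_space N \<mu> ..
  have i: "integrable (N \<Otimes>\<^sub>M \<mu>) (\<lambda>z. iexp (u * (fst z + snd z)))"
    by (rule P.integrable_const_bound[of _ 1]) auto
  have "char (N \<star> \<mu>) u = (CLINT z|N \<Otimes>\<^sub>M \<mu>. iexp (u * (fst z + snd z)))"
    unfolding char_def convolution_def by (subst integral_distr) (auto simp: split_beta')
  also have "\<dots> = (CLINT x|N. CLINT y|\<mu>. iexp (u * (x + y)))"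
    using P.integral_fst'[OF i] by simp
  also have "\<dots> = (CLINT x|N. CLINT y|\<mu>. iexp (u * x) * iexp (u * y))"
    by (simp add: algebra_simps exp_add)
  also have "\<dots> = char N u * char \<mu> u"
    unfolding char_def by simp
  finally show ?thesis .
qed

text \<open>
  Adding an independent variable \<open>y\<close> of law \<open>\<mu>\<close> moves the argument of \<open>g\<close> by \<open>y\<close>, so the cost is
  the mean under \<open>\<mu>\<close> of a modulus of continuity \<open>w\<close>. The bound does not depend on \<open>N\<close>, so it can
  be iterated.
\<close>
lemma integral_convolution_diff_le:
  fixes g :: "real \<Rightarrow> 'b :: {banach, second_countable_topology}"
  assumes "real_distribution N" "real_distribution \<mu>"
    and g [measurable]: "g \<in> borel_measurable borel"
    and bdd: "\<And>x. norm (g x) \<le> B"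
    and modulus: "\<And>x y. norm (g x - g y) \<le> w (x - y)"
    and w: "integrable \<mu> w"
  shows "norm (integral\<^sup>L (N \<star> \<mu>) g - integral\<^sup>L N g) \<le> integral\<^sup>L \<mu> w"
proof -
  interpret N: real_distribution N by fact
  interpret \<mu>: real_distribution \<mu> by fact
  interpret P: pair_prob_space N \<mu> ..
  have i1: "integrable (N \<Otimes>\<^sub>M \<mu>) (\<lambda>z. g (fst z + snd z))"
    by (rule P.integrable_const_bound[of _ B]) (auto simp: bdd)
  have i2: "integrable N g"
    by (rule N.integrable_const_bound[of _ B]) (auto simp: bdd)
  have i3: "integrable \<mu> (\<lambda>y. g (x + y))" for x
    by (rule \<mu>.integrable_const_bound[of _ B]) (auto simp: bdd)
  have i4: "integrable N (\<lambda>x. \<integral>y. g (x + y) \<partial>\<mu>)"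
    using P.integrable_fst'[OF i1] by simp
  have e: "integral\<^sup>L (N \<star> \<mu>) g = (\<integral>x. \<integral>y. g (x + y) \<partial>\<mu> \<partial>N)"
    unfolding convolution_def using P.integral_fst'[OF i1]
    by (subst integral_distr) (auto simp: split_beta')
  have "integral\<^sup>L (N \<star> \<mu>) g - integral\<^sup>L N g = (\<integral>x. (\<integral>y. g (x + y) \<partial>\<mu>) - g x \<partial>N)"
    unfolding e by (rule Bochner_Integration.integral_diff[symmetric, OF i4 i2])
  also have "norm \<dots> \<le> (\<integral>x. integral\<^sup>L \<mu> w \<partial>N)"
  proof (rule Bochner_Integration.integral_norm_bound_integral)
    show "integrable N (\<lambda>x. (\<integral>y. g (x + y) \<partial>\<mu>) - g x)"
      using i4 i2 by (rule Bochner_Integration.integrable_diff)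
    show "integrable N (\<lambda>x. integral\<^sup>L \<mu> w)" by simp
    fix x
    have "(\<integral>y. g (x + y) \<partial>\<mu>) - g x = (\<integral>y. g (x + y) - g x \<partial>\<mu>)"
      using i3[of x] \<mu>.prob_space by (subst Bochner_Integration.integral_diff) auto
    also have "norm \<dots> \<le> integral\<^sup>L \<mu> w"
      using i3[of x] w modulus[of "x + _" x] by (intro Bochner_Integration.integral_norm_bound_integral) auto
    finally show "norm ((\<integral>y. g (x + y) \<partial>\<mu>) - g x) \<le> integral\<^sup>L \<mu> w" .
  qed
  also have "\<dots> = integral\<^sup>L \<mu> w" using N.prob_space by simp
  finally show ?thesis .
qed

text \<open>
  One step of a random walk that imitates the jumps: with probability \<open>a \<nu>{|x| > d}\<close> it is a jump
  larger than \<open>d\<close>, distributed according to the normalised restriction of \<open>\<nu>\<close>, and otherwise it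
  is 0. Since \<open>\<nu>{|x| > d}\<close> is at most \<open>d\<^sup>-\<^sup>p\<close> times the \<open>p\<close>-th moment of \<open>\<nu>\<close> by Markov's
  inequality, the assumption that links \<open>a\<close> and \<open>d\<close> makes this a probability.
\<close>
lemma truncated_jump_law:
  fixes \<nu> :: "real \<Rightarrow> real" and p d a :: real
  assumes [measurable]: "\<nu> \<in> borel_measurable borel" and nn: "\<And>x. 0 \<le> \<nu> x"
    and p: "0 < p" and int: "integrable lborel (\<lambda>x. \<bar>x\<bar> powr p * \<nu> x)"
    and d: "0 < d" and a: "0 \<le> a"
    and small: "a * (LINT x|lborel. \<bar>x\<bar> powr p * \<nu> x) \<le> d powr p"
  obtains \<mu> where "real_distribution \<mu>"
    "integrable \<mu> (\<lambda>x. \<bar>x\<bar> powr p)"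
    "(LINT x|\<mu>. \<bar>x\<bar> powr p) \<le> a * (LINT x|lborel. \<bar>x\<bar> powr p * \<nu> x)"
    "\<And>u. char \<mu> u = 1 + complex_of_real a *
        (CLINT x|lborel. indicator {x. d < \<bar>x\<bar>} x * ((iexp (u * x) - 1) * \<nu> x))"
proof -
  define C where "C = (LINT x|lborel. \<bar>x\<bar> powr p * \<nu> x)"
  define k where "k x = indicator {x. d < \<bar>x\<bar>} x * \<nu> x" for x :: real
  have [measurable]: "k \<in> borel_measurable borel" unfolding k_def by measurable
  have kn: "0 \<le> k x" for x by (simp add: k_def nn)
  have kle: "k x \<le> d powr (-p) * (\<bar>x\<bar> powr p * \<nu> x)" for x
  proof (cases "d < \<bar>x\<bar>")
    case True
    then have "d powr p \<le> \<bar>x\<bar> powr p" using d p by (intro powr_mono2) auto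
    then have "1 * \<nu> x \<le> (d powr (-p) * \<bar>x\<bar> powr p) * \<nu> x"
      using d nn[of x] by (intro mult_right_mono) (auto simp: powr_minus field_simps)
    then show ?thesis using True by (simp add: k_def)
  qed (simp add: k_def nn)
  have ik: "integrable lborel k"
    by (rule Bochner_Integration.integrable_bound[OF integrable_mult_right[OF int, of "d powr (-p)"]])
       (use kle kn in \<open>auto simp: nn\<close>)
  have kC: "a * integral\<^sup>L lborel k \<le> 1"
  proof -
    have "integral\<^sup>L lborel k \<le> d powr (-p) * C"
      unfolding C_def using ik int kle
      by (subst integral_mult_right_zero[symmetric]) (intro integral_mono, auto)
    then have "a * integral\<^sup>L lborel k \<le> d powr (-p) * (a * C)"
      using a by (metis mult.left_commute mult_left_mono)
    also have "\<dots> \<le> d powr (-p) * d powr p"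
      using small by (intro mult_left_mono) (auto simp: C_def)
    also have "\<dots> = 1" using d by (simp add: powr_minus)
    finally show ?thesis .
  qed
  \<comment> \<open>The atom at 0 is obtained without forming a mixture of measures: the missing mass is spread
      uniformly over \<open>[-d, d]\<close>, and the map \<open>h\<close> then collapses this interval to 0.\<close>
  define l where "l = (1 - a * integral\<^sup>L lborel k) / (2 * d)"
  have l: "0 \<le> l" using kC d by (simp add: l_def)
  define f where "f x = a * k x + l * indicator {-d..d} x" for x :: real
  have [measurable]: "f \<in> borel_measurable borel" unfolding f_def by measurable
  have fn: "0 \<le> f x" for x using a kn l by (simp add: f_def)
  have if': "integrable lborel f" unfolding f_def using ik d
    by (intro Bochner_Integration.integrable_add integrable_mult_right) auto
  have "integral\<^sup>L lborel f = 1"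
    unfolding f_def using ik d by (simp add: l_def)
  then have pf: "prob_space (density lborel f)"
    using if' fn by (intro prob_spaceI) (simp add: emeasure_density nn_integral_eq_integral)
  define h where "h x = indicator {x. d < \<bar>x\<bar>} x * x" for x :: real
  have [measurable]: "h \<in> borel_measurable borel" unfolding h_def by measurable
  interpret D: prob_space "density lborel f" by fact
  define \<mu> where "\<mu> = distr (density lborel f) borel h"
  have \<mu>: "real_distribution \<mu>" unfolding \<mu>_def by (rule D.real_distribution_distr) simp
  have fh: "f x * F (h x) = a * (indicator {x. d < \<bar>x\<bar>} x * (F x * \<nu> x))"
    if "F 0 = 0" for F :: "real \<Rightarrow> real" and x
    using that by (auto simp: f_def k_def h_def indicator_def)
  have fhc: "f x *\<^sub>R F (h x) = a * (indicator {x. d < \<bar>x\<bar>} x * (F x * \<nu> x))"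
    if "F 0 = 0" for F :: "real \<Rightarrow> complex" and x
    using that by (auto simp: f_def k_def h_def indicator_def scaleR_conv_of_real)
  have it: "integrable lborel (\<lambda>x. indicator {x. d < \<bar>x\<bar>} x * (\<bar>x\<bar> powr p * \<nu> x))"
    by (rule Bochner_Integration.integrable_bound[OF int]) (auto simp: indicator_def nn)
  have "integrable \<mu> (\<lambda>x. \<bar>x\<bar> powr p)"
    unfolding \<mu>_def using it by (auto simp: integrable_distr_eq integrable_density fn
        fh[of "\<lambda>x. \<bar>x\<bar> powr p"])
  moreover have "(LINT x|\<mu>. \<bar>x\<bar> powr p) \<le> a * (LINT x|lborel. \<bar>x\<bar> powr p * \<nu> x)"
  proof -
    have "(LINT x|\<mu>. \<bar>x\<bar> powr p)
        = a * (LINT x|lborel. indicator {x. d < \<bar>x\<bar>} x * (\<bar>x\<bar> powr p * \<nu> x))"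
      unfolding \<mu>_def by (simp add: integral_distr integral_density fn fh[of "\<lambda>x. \<bar>x\<bar> powr p"])
    also have "\<dots> \<le> a * (LINT x|lborel. \<bar>x\<bar> powr p * \<nu> x)"
      using a it int by (intro mult_left_mono integral_mono) (auto simp: indicator_def nn)
    finally show ?thesis .
  qed
  moreover have "char \<mu> u = 1 + complex_of_real a *
        (CLINT x|lborel. indicator {x. d < \<bar>x\<bar>} x * ((iexp (u * x) - 1) * \<nu> x))" for u
  proof -
    interpret \<mu>: real_distribution \<mu> by fact
    have "char \<mu> u - 1 = (CLINT x|\<mu>. iexp (u * x) - 1)"
      unfolding char_def using \<mu>.prob_space
      by (subst Bochner_Integration.integral_diff) (auto intro!: \<mu>.integrable_iexp)
    also have "\<dots> = (CLINT x|lborel. f x *\<^sub>R (iexp (u * h x) - 1))"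
      unfolding \<mu>_def by (simp add: integral_distr integral_density fn)
    also have "\<dots> = (CLINT x|lborel. complex_of_real a *
        (indicator {x. d < \<bar>x\<bar>} x * ((iexp (u * x) - 1) * \<nu> x)))"
      by (intro Bochner_Integration.integral_cong fhc[of "\<lambda>x. iexp (u * x) - 1"]) auto
    also have "\<dots> = complex_of_real a *
        (CLINT x|lborel. indicator {x. d < \<bar>x\<bar>} x * ((iexp (u * x) - 1) * \<nu> x))"
      by (rule integral_mult_right_zero)
    finally show ?thesis by (simp add: algebra_simps)
  qed
  ultimately show thesis using \<mu> that by blast
qed

text \<open>
  The Poisson limit and the central limit theorem below both reduce to this statement about powers
  of characteristic functions. The bound on the modulus keeps \<open>1 + z\<^sub>n / n\<close> and \<open>exp (z\<^sub>n / n)\<close>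
  in the unit disc, where the difference of two \<open>n\<close>-th powers is at most \<open>n\<close> times the difference
  of the bases, and the bases differ by \<open>O(1 / n\<^sup>2)\<close>.
\<close>
lemma one_plus_div_power_tendsto_exp:
  fixes z :: "nat \<Rightarrow> complex"
  assumes z: "z \<longlonglongrightarrow> l" and le1: "\<And>n. cmod (1 + z n / of_nat (Suc n)) \<le> 1"
  shows "(\<lambda>n. (1 + z n / of_nat (Suc n)) ^ Suc n) \<longlonglongrightarrow> exp l"
proof -
  have "Bseq z" using z by (simp add: convergentI convergent_imp_Bseq)
  then obtain B where B: "0 < B" "\<And>n. cmod (z n) \<le> B" by (auto simp: Bseq_def)
  define w where "w n = z n / of_nat (Suc n)" for n
  have wB: "cmod (w n) \<le> B / real (Suc n)" for n
    using B(2)[of n] by (simp add: w_def norm_divide divide_right_mono del: of_nat_Suc)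
  \<comment> \<open>\<open>|1 + w| \<le> 1\<close> forces \<open>Re w \<le> 0\<close>, hence \<open>|exp w| \<le> 1\<close>.\<close>
  have Re: "Re (w n) \<le> 0" for n
    using complex_Re_le_cmod[of "1 + w n"] le1[of n] by (simp add: w_def del: of_nat_Suc)
  have bound: "cmod ((1 + w n) ^ Suc n - exp (z n)) \<le> exp B * B\<^sup>2 * (1 / real (Suc n))" for n
  proof -
    have "exp (z n) = exp (w n) ^ Suc n"
      by (simp add: w_def exp_of_nat_mult[symmetric] del: of_nat_Suc power_Suc)
    then have "cmod ((1 + w n) ^ Suc n - exp (z n)) \<le> real (Suc n) * cmod ((1 + w n) - exp (w n))"
      using le1[of n] Re[of n] by (simp only:) (rule norm_power_diff, auto simp: w_def)
    also have "cmod ((1 + w n) - exp (w n)) \<le> exp \<bar>Re (w n)\<bar> * cmod (w n) ^ 2"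
      using Taylor_exp[of "w n" 1] by (simp add: norm_minus_commute power2_eq_square mult_ac)
    also have "\<dots> \<le> exp B * (B / real (Suc n)) ^ 2"
    proof (intro mult_mono power_mono wB)
      have "\<bar>Re (w n)\<bar> \<le> B / real (Suc n)" using abs_Re_le_cmod[of "w n"] wB[of n] by linarith
      also have "\<dots> \<le> B" using B by (simp add: field_simps)
      finally show "exp \<bar>Re (w n)\<bar> \<le> exp B" by simp
    qed auto
    also have "real (Suc n) * (exp B * (B / real (Suc n)) ^ 2) = exp B * B\<^sup>2 * (1 / real (Suc n))"
      by (simp add: power2_eq_square field_simps del: of_nat_Suc)
    finally show ?thesis by (simp add: mult_left_mono)
  qed
  have "(\<lambda>n. exp B * B\<^sup>2 * (1 / real (Suc n))) \<longlonglongrightarrow> exp B * B\<^sup>2 * 0"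
    by (intro tendsto_mult_left) (rule LIMSEQ_Suc[OF lim_1_over_n])
  then have "(\<lambda>n. (1 + w n) ^ Suc n - exp (z n)) \<longlonglongrightarrow> 0"
    by (intro Lim_null_comparison[OF always_eventually, OF allI, OF bound]) simp
  moreover have "(\<lambda>n. exp (z n)) \<longlonglongrightarrow> exp l" using z by (rule tendsto_exp)
  ultimately have "(\<lambda>n. (1 + w n) ^ Suc n - exp (z n) + exp (z n)) \<longlonglongrightarrow> 0 + exp l"
    by (rule tendsto_add)
  then show ?thesis by (simp add: w_def del: power_Suc of_nat_Suc)
qed

text \<open>
  The law \<open>N\<close> is that of a variable with law \<open>G\<close> plus an independent pure jump part run for time
  \<open>t\<close>. Although the jump measure may be infinite, the jumps act on a \<open>p\<close>-Hoelder function \<open>g\<close> only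
  through their \<open>p\<close>-th moment. The reason is an approximation by a random walk: the \<open>n\<close>-th walk
  starts from \<open>G\<close> and takes \<open>n + 1\<close> independent steps, each of them a jump larger than \<open>d\<^sub>n\<close> with
  intensity \<open>t / (n + 1)\<close>. Its steps together cost at most \<open>H\<close> times \<open>t\<close> times the \<open>p\<close>-th moment
  of \<open>\<nu>\<close>. As \<open>d\<^sub>n \<rightarrow> 0\<close> the characteristic functions converge to that of \<open>N\<close>, so the bound
  passes to the limit. In this way neither a Poisson random measure nor the jump part itself has to
  be constructed: only the limit law \<open>N\<close> must be given.
\<close>
lemma integral_diff_le_jumps:
  fixes g :: "real \<Rightarrow> 'b :: {banach, second_countable_topology}" and \<nu> :: "real \<Rightarrow> real"
  assumes N: "real_distribution N" and G: "real_distribution G"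
    and \<nu> [measurable]: "\<nu> \<in> borel_measurable borel" and nn: "\<And>x. 0 \<le> \<nu> x"
    and p: "0 < p" "p \<le> 1" and int: "integrable lborel (\<lambda>x. \<bar>x\<bar> powr p * \<nu> x)"
    and t: "0 \<le> t"
    and char_N: "\<And>u. char N u = char G u *
        exp (complex_of_real t * (CLINT x|lborel. (iexp (u * x) - 1) * \<nu> x))"
    and cont: "\<And>x. isCont g x" and bdd: "\<And>x. norm (g x) \<le> B"
    and hoelder: "\<And>x y. norm (g x - g y) \<le> H * \<bar>x - y\<bar> powr p"
  shows "norm (integral\<^sup>L N g - integral\<^sup>L G g) \<le> H * (t * (LINT x|lborel. \<bar>x\<bar> powr p * \<nu> x))"
proof -
  define C where "C = (LINT x|lborel. \<bar>x\<bar> powr p * \<nu> x)"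
  have C: "0 \<le> C" unfolding C_def by (intro Bochner_Integration.integral_nonneg) (auto simp: nn)
  have H: "0 \<le> H" using hoelder[of 1 0] norm_ge_zero[of "g 1 - g 0"] by (simp del: norm_ge_zero)
  have g [measurable]: "g \<in> borel_measurable borel"
    using cont by (intro borel_measurable_continuous_onI continuous_at_imp_continuous_on) auto
  \<comment> \<open>The threshold that \<open>truncated_jump_law\<close> asks for; the added 1 keeps it positive
      when there are no jumps.\<close>
  define d where "d n = ((t * C + 1) / real (Suc n)) powr (1 / p)" for n
  define a where "a n = t / real (Suc n)" for n
  define \<psi> where "\<psi> n u = (CLINT x|lborel. indicator {x. d n < \<bar>x\<bar>} x * ((iexp (u * x) - 1) * \<nu> x))"
    for n u
  have tC: "0 \<le> t * C" using t C by simp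
  have d: "0 < d n" for n using tC by (simp add: d_def add_nonneg_pos del: of_nat_Suc)
  have small: "a n * C \<le> d n powr p" for n
  proof -
    have "d n powr p = (t * C + 1) / real (Suc n)"
      using p tC by (simp add: d_def powr_powr del: of_nat_Suc)
    moreover have "a n * C = t * C / real (Suc n)" by (simp add: a_def)
    ultimately show ?thesis by (simp add: divide_right_mono del: of_nat_Suc)
  qed
  have "\<exists>\<mu>. real_distribution \<mu> \<and> integrable \<mu> (\<lambda>x. \<bar>x\<bar> powr p) \<and>
      (LINT x|\<mu>. \<bar>x\<bar> powr p) \<le> a n * C \<and> (\<forall>u. char \<mu> u = 1 + complex_of_real (a n) * \<psi> n u)" for n
  proof -
    have an: "0 \<le> a n" using t by (simp add: a_def)
    show ?thesis
    proof (rule truncated_jump_law[OF \<nu> nn p(1) int d[of n] an small[of n, unfolded C_def]])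
      fix m :: "real measure"
      assume "real_distribution m" "integrable m (\<lambda>x. \<bar>x\<bar> powr p)"
        "(LINT x|m. \<bar>x\<bar> powr p) \<le> a n * (LINT x|lborel. \<bar>x\<bar> powr p * \<nu> x)"
        "\<And>u. char m u = 1 + complex_of_real (a n) *
          (CLINT x|lborel. indicator {x. d n < \<bar>x\<bar>} x * ((iexp (u * x) - 1) * \<nu> x))"
      then show ?thesis unfolding C_def \<psi>_def by (intro exI[of _ m] conjI allI)
    qed
  qed
  then obtain \<mu> where \<mu>: "\<And>n. real_distribution (\<mu> n)" "\<And>n. integrable (\<mu> n) (\<lambda>x. \<bar>x\<bar> powr p)"
      "\<And>n. (LINT x|\<mu> n. \<bar>x\<bar> powr p) \<le> a n * C"
      "\<And>n u. char (\<mu> n) u = 1 + complex_of_real (a n) * \<psi> n u"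
    by metis
  define K where "K n j = ((\<lambda>Q. Q \<star> \<mu> n) ^^ j) G" for n j
  have K: "real_distribution (K n j)" for n j
    by (induction j) (auto simp: K_def G intro!: real_distribution_convolution \<mu>)
  have char_K: "char (K n j) u = char G u * char (\<mu> n) u ^ j" for n j u
  proof (induction j)
    case (Suc j)
    have "K n (Suc j) = (K n j \<star> \<mu> n)" by (simp add: K_def)
    then show ?case using Suc K \<mu> by (simp add: char_convolution)
  qed (simp add: K_def)
  have diff_K: "norm (integral\<^sup>L (K n j) g - integral\<^sup>L G g) \<le> real j * (H * (a n * C))" for n j
  proof (induction j)
    case (Suc j)
    have "K n (Suc j) = (K n j \<star> \<mu> n)" by (simp add: K_def)
    then have "norm (integral\<^sup>L (K n (Suc j)) g - integral\<^sup>L (K n j) g) \<le> (LINT x|\<mu> n. H * \<bar>x\<bar> powr p)"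
      using integral_convolution_diff_le[OF K \<mu>(1) g bdd hoelder, of n n j] \<mu>(2)[of n] by simp
    also have "\<dots> \<le> H * (a n * C)" using \<mu>(3)[of n] H by (simp add: mult_left_mono)
    finally show ?case
      using Suc norm_triangle_ineq[of "integral\<^sup>L (K n (Suc j)) g - integral\<^sup>L (K n j) g"
          "integral\<^sup>L (K n j) g - integral\<^sup>L G g"] by (simp add: algebra_simps)
  qed (simp add: K_def)
  have d0: "d \<longlonglongrightarrow> 0"
  proof -
    have "(\<lambda>n. (t * C + 1) * (1 / real (Suc n))) \<longlonglongrightarrow> (t * C + 1) * 0"
      by (intro tendsto_mult_left) (rule LIMSEQ_Suc[OF lim_1_over_n])
    then have *: "(\<lambda>n. (t * C + 1) / real (Suc n)) \<longlonglongrightarrow> 0" by simp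
    have "((\<lambda>n. ((t * C + 1) / real (Suc n)) powr (1 / p)) \<longlongrightarrow> 0) sequentially"
      by (rule tendsto_zero_powrI[OF * tendsto_const]) (use p tC in auto)
    then show ?thesis by (simp add: d_def[abs_def])
  qed
  have char_conv: "(\<lambda>n. char (K n (Suc n)) u) \<longlonglongrightarrow> char N u" for u
  proof -
    have "(\<lambda>n. \<psi> n u) \<longlonglongrightarrow> (CLINT x|lborel. (iexp (u * x) - 1) * \<nu> x)"
      unfolding \<psi>_def
    proof (rule integral_dominated_convergence[where w="\<lambda>x. (2 + \<bar>u\<bar>) * (\<bar>x\<bar> powr p * \<nu> x)"])
      show "integrable lborel (\<lambda>x. (2 + \<bar>u\<bar>) * (\<bar>x\<bar> powr p * \<nu> x))"
        using int by (rule integrable_mult_right)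
      show "AE x in lborel. (\<lambda>n. indicator {x. d n < \<bar>x\<bar>} x * ((iexp (u * x) - 1) * \<nu> x))
          \<longlonglongrightarrow> (iexp (u * x) - 1) * \<nu> x"
      proof (rule AE_I2)
        fix x :: real
        show "(\<lambda>n. indicator {x. d n < \<bar>x\<bar>} x * ((iexp (u * x) - 1) * \<nu> x))
          \<longlonglongrightarrow> (iexp (u * x) - 1) * \<nu> x"
        proof (cases "x = 0")
          case False
          then have "eventually (\<lambda>n. d n < \<bar>x\<bar>) sequentially"
            using d0 by (intro order_tendstoD(2)) auto
          then show ?thesis
            by (intro tendsto_eventually) (erule eventually_mono, simp)
        qed simp
      qed
      fix n
      show "AE x in lborel. norm (indicator {x. d n < \<bar>x\<bar>} x * ((iexp (u * x) - 1) * \<nu> x))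
          \<le> (2 + \<bar>u\<bar>) * (\<bar>x\<bar> powr p * \<nu> x)"
      proof (rule AE_I2)
        fix x :: real
        have "cmod (iexp (u * x) - 1) \<le> min 2 (\<bar>u\<bar> * \<bar>x\<bar>)"
          using cmod_iexp_diff_le[of "u * x" 0] norm_triangle_ineq4[of "iexp (u * x)" 1]
          by (simp add: abs_mult)
        also have "\<dots> \<le> (2 + \<bar>u\<bar>) * min 1 \<bar>x\<bar>"
          by (auto simp: min_def algebra_simps intro: mult_left_mono)
        also have "\<dots> \<le> (2 + \<bar>u\<bar>) * \<bar>x\<bar> powr p"
          using min_1_le_powr[OF p, of "\<bar>x\<bar>"] by (intro mult_left_mono) auto
        finally have "cmod (iexp (u * x) - 1) * \<nu> x \<le> (2 + \<bar>u\<bar>) * \<bar>x\<bar> powr p * \<nu> x"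
          using nn by (intro mult_right_mono) auto
        then show "norm (indicator {x. d n < \<bar>x\<bar>} x * ((iexp (u * x) - 1) * \<nu> x))
          \<le> (2 + \<bar>u\<bar>) * (\<bar>x\<bar> powr p * \<nu> x)"
          using nn[of x] by (auto simp: norm_mult indicator_def mult.assoc)
      qed
    qed measurable
    then have z: "(\<lambda>n. complex_of_real t * \<psi> n u) \<longlonglongrightarrow>
        complex_of_real t * (CLINT x|lborel. (iexp (u * x) - 1) * \<nu> x)"
      by (rule tendsto_mult_left)
    have e: "char (\<mu> n) u = 1 + complex_of_real t * \<psi> n u / of_nat (Suc n)" for n
      by (simp add: \<mu>(4) a_def)
    have "(\<lambda>n. (char (\<mu> n) u) ^ Suc n) \<longlonglongrightarrow>
        exp (complex_of_real t * (CLINT x|lborel. (iexp (u * x) - 1) * \<nu> x))"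
      unfolding e by (rule one_plus_div_power_tendsto_exp[OF z])
        (use real_distribution.cmod_char_le_1[OF \<mu>(1)] in \<open>simp add: e[symmetric] del: of_nat_Suc\<close>)
    then show ?thesis unfolding char_N char_K by (rule tendsto_mult_left)
  qed
  have "weak_conv_m (\<lambda>n. K n (Suc n)) N"
    by (rule levy_continuity[OF K N char_conv])
  then have "(\<lambda>n. integral\<^sup>L (K n (Suc n)) g) \<longlonglongrightarrow> integral\<^sup>L N g"
    by (rule weak_conv_imp_integral_bdd_continuous_conv[OF K N _ cont bdd])
  then have "(\<lambda>n. norm (integral\<^sup>L (K n (Suc n)) g - integral\<^sup>L G g)) \<longlonglongrightarrow>
      norm (integral\<^sup>L N g - integral\<^sup>L G g)"
    by (intro tendsto_intros)
  moreover have "norm (integral\<^sup>L (K n (Suc n)) g - integral\<^sup>L G g) \<le> H * (t * C)" for n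
    using diff_K[of n "Suc n"] by (simp add: a_def field_simps del: of_nat_Suc)
  ultimately show ?thesis
    unfolding C_def by (intro LIMSEQ_le_const2) auto
qed

text \<open>
  This is \<open>integral_diff_le_jumps\<close> with \<open>G\<close> the unit mass at 0 and with the truncations of \<open>|x|\<^sup>p\<close>, which are
  bounded and Hoelder continuous with constant 1; the truncation is removed by Fatou's lemma.
\<close>
lemma pure_jump_fractional_moment:
  fixes \<nu> :: "real \<Rightarrow> real"
  assumes N: "real_distribution N"
    and \<nu> [measurable]: "\<nu> \<in> borel_measurable borel" and nn: "\<And>x. 0 \<le> \<nu> x"
    and p: "0 < p" "p \<le> 1" and int: "integrable lborel (\<lambda>x. \<bar>x\<bar> powr p * \<nu> x)"
    and t: "0 \<le> t"
    and char_N: "\<And>u. char N u =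
        exp (complex_of_real t * (CLINT x|lborel. (iexp (u * x) - 1) * \<nu> x))"
  shows "(\<integral>\<^sup>+x. ennreal (\<bar>x\<bar> powr p) \<partial>N) \<le> ennreal (t * (LINT x|lborel. \<bar>x\<bar> powr p * \<nu> x))"
proof -
  define C where "C = (LINT x|lborel. \<bar>x\<bar> powr p * \<nu> x)"
  interpret N: real_distribution N by fact
  define g where "g m x = min (\<bar>x\<bar> powr p) (real m)" for m and x :: real
  have [measurable]: "g m \<in> borel_measurable borel" for m unfolding g_def by measurable
  have ps: "prob_space (return borel (0::real))" by (rule prob_space_return) simp
  have G: "real_distribution (return borel (0::real))"
    using ps by (simp add: real_distribution_def real_distribution_axioms_def)
  have cG: "char (return borel 0) u = 1" for u
    unfolding char_def by (subst integral_return) auto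
  have iN: "integrable N (g m)" for m
    by (rule N.integrable_const_bound[of _ "real m"]) (auto simp: g_def)
  have bound: "(\<integral>\<^sup>+x. ennreal (g m x) \<partial>N) \<le> ennreal (t * C)" for m
  proof -
    have "norm (integral\<^sup>L N (g m) - integral\<^sup>L (return borel 0) (g m)) \<le> 1 * (t * C)"
      unfolding C_def
    proof (rule integral_diff_le_jumps[OF N G \<nu> nn p int t])
      show "char N u = char (return borel 0) u *
          exp (complex_of_real t * (CLINT x|lborel. (iexp (u * x) - 1) * \<nu> x))" for u
        by (simp add: char_N cG)
      show "isCont (g m) x" for x
        unfolding g_def using p by (intro continuous_intros isCont_abs_powr) auto
      show "norm (g m x) \<le> real m" for x by (simp add: g_def)
      show "norm (g m x - g m y) \<le> 1 * \<bar>x - y\<bar> powr p" for x y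
        using abs_powr_diff_le[OF p, of x y] by (auto simp: g_def min_def)
    qed
    then have "integral\<^sup>L N (g m) \<le> t * C"
      by (subst (asm) integral_return) (auto simp: g_def)
    then show ?thesis
      using iN[of m] by (subst nn_integral_eq_integral) (auto simp: g_def ennreal_leI)
  qed
  have lim: "(\<lambda>m. ennreal (g m x)) \<longlonglongrightarrow> ennreal (\<bar>x\<bar> powr p)" for x
  proof (rule tendsto_eventually)
    obtain k :: nat where "\<bar>x\<bar> powr p \<le> real k" using real_arch_simple by blast
    then show "eventually (\<lambda>m. ennreal (g m x) = ennreal (\<bar>x\<bar> powr p)) sequentially"
      by (intro eventually_sequentiallyI[of k]) (auto simp: g_def min_def)
  qed
  have "(\<integral>\<^sup>+x. ennreal (\<bar>x\<bar> powr p) \<partial>N) = (\<integral>\<^sup>+x. liminf (\<lambda>m. ennreal (g m x)) \<partial>N)"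
    by (intro nn_integral_cong) (simp add: lim_imp_Liminf[OF _ lim])
  also have "\<dots> \<le> liminf (\<lambda>m. \<integral>\<^sup>+x. ennreal (g m x) \<partial>N)"
    by (intro nn_integral_liminf) auto
  also have "\<dots> \<le> ennreal (t * C)"
    by (rule Liminf_le) (simp_all add: bound)
  finally show ?thesis unfolding C_def .
qed

section \<open>Absolute moments of the normal law and the central limit theorem for one row\<close>

lemma powr_le_1_plus_sq:
  fixes x r :: real
  assumes "0 \<le> r" "r \<le> 2"
  shows "\<bar>x\<bar> powr r \<le> 1 + x\<^sup>2"
proof (cases "\<bar>x\<bar> \<le> 1")
  case True
  then have "\<bar>x\<bar> powr r \<le> 1" using assms powr_mono'[of 0 r "\<bar>x\<bar>"] by (auto split: if_splits)
  then show ?thesis by (smt (verit) zero_le_power2)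
next
  case False
  then have "\<bar>x\<bar> powr r \<le> \<bar>x\<bar> powr 2" using assms by (intro powr_mono) auto
  also have "\<dots> = x\<^sup>2" using False by (simp add: powr_numeral)
  finally show ?thesis by simp
qed

lemma integrable_abs_powr_std_normal:
  assumes "0 \<le> r" "r \<le> 2"
  shows "integrable std_normal_distribution (\<lambda>x. \<bar>x\<bar> powr r)"
proof -
  interpret real_distribution std_normal_distribution by (rule real_dist_normal_dist)
  have "integrable std_normal_distribution (\<lambda>x. 1 + x\<^sup>2)"
    by (intro Bochner_Integration.integrable_add integrable_std_normal_distribution_moment) simp
  then show ?thesis
    by (rule Bochner_Integration.integrable_bound) (use powr_le_1_plus_sq[OF assms] in auto)
qed

lemma gauss_abs_moment_pos:
  assumes "0 < r" "r \<le> 2"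
  shows "0 < gauss_abs_moment r"
proof -
  have "gauss_abs_moment r \<noteq> 0"
  proof
    assume "gauss_abs_moment r = 0"
    then have "AE x in std_normal_distribution. \<bar>x\<bar> powr r = 0"
      unfolding gauss_abs_moment_def
      by (subst (asm) integral_nonneg_eq_0_iff_AE) (use integrable_abs_powr_std_normal assms in auto)
    then have "AE x in lborel. (x::real) = 0"
      by (subst (asm) AE_density) (auto simp: normal_density_pos)
    then have "AE x in lborel :: real measure. False"
      using AE_lborel_singleton[of "0::real"] by eventually_elim simp
    then show False by (simp add: eventually_False ae_filter_eq_bot_iff)
  qed
  moreover have "0 \<le> gauss_abs_moment r"
    unfolding gauss_abs_moment_def by (intro Bochner_Integration.integral_nonneg) auto
  ultimately show ?thesis by simp
qed

text \<open>
  For an increment that is exactly Gaussian with variance \<open>\<sigma>\<^sup>2 \<Delta>\<close>, this is its contribution to the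
  estimation error, expressed through the standardised increment \<open>x\<close>.
\<close>
definition centred_power :: "real \<Rightarrow> real \<Rightarrow> real \<Rightarrow> real" where
  "centred_power r \<sigma> x = \<sigma> powr r * (\<bar>x\<bar> powr r / gauss_abs_moment r - 1)"

lemma centred_power_measurable [measurable]: "centred_power r \<sigma> \<in> borel_measurable borel"
  unfolding centred_power_def by measurable

text \<open>
  The variance is strictly positive because \<open>|x|\<^sup>r\<close> takes each positive value at two points only,
  and so is not almost surely constant. Positivity matters since the limit \<^const>\<open>normal_law\<close> is a
  probability measure only for a positive variance.
\<close>
lemma centred_power_moments:
  assumes "0 < r" "r \<le> 1" "0 < \<sigma>"
  shows "integrable std_normal_distribution (centred_power r \<sigma>)"
    and "(LINT x|std_normal_distribution. centred_power r \<sigma> x) = 0"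
    and "integrable std_normal_distribution (\<lambda>x. (centred_power r \<sigma> x)\<^sup>2)"
    and "(LINT x|std_normal_distribution. (centred_power r \<sigma> x)\<^sup>2) =
      \<sigma> powr (2 * r) * (gauss_abs_moment (2 * r) / (gauss_abs_moment r)\<^sup>2 - 1)"
    and "0 < \<sigma> powr (2 * r) * (gauss_abs_moment (2 * r) / (gauss_abs_moment r)\<^sup>2 - 1)"
proof -
  interpret N: real_distribution std_normal_distribution by (rule real_dist_normal_dist)
  define m where "m = gauss_abs_moment r"
  have m: "0 < m" unfolding m_def using assms by (intro gauss_abs_moment_pos) auto
  have i1: "integrable std_normal_distribution (\<lambda>x. \<bar>x\<bar> powr r)"
    using assms by (intro integrable_abs_powr_std_normal) auto
  have i2: "integrable std_normal_distribution (\<lambda>x. \<bar>x\<bar> powr (2 * r))"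
    using assms by (intro integrable_abs_powr_std_normal) auto
  show ic: "integrable std_normal_distribution (centred_power r \<sigma>)"
    unfolding centred_power_def m_def[symmetric] using i1 by auto
  show "(LINT x|std_normal_distribution. centred_power r \<sigma> x) = 0"
    unfolding centred_power_def m_def[symmetric] using i1 m N.prob_space
    by (simp add: gauss_abs_moment_def[symmetric] m_def)
  have sq: "(centred_power r \<sigma> x)\<^sup>2 =
      \<sigma> powr (2 * r) * (\<bar>x\<bar> powr (2 * r) / m\<^sup>2 - 2 / m * \<bar>x\<bar> powr r + 1)" for x
  proof -
    have *: "z powr (2 * r) = (z powr r)\<^sup>2" for z :: real
      by (simp add: power2_eq_square powr_add[symmetric])
    show ?thesis
      unfolding centred_power_def m_def[symmetric] *
      by (simp add: power_mult_distrib power2_diff power_divide)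
  qed
  show i: "integrable std_normal_distribution (\<lambda>x. (centred_power r \<sigma> x)\<^sup>2)"
    unfolding sq using i1 i2 by auto
  have "(LINT x|std_normal_distribution. (centred_power r \<sigma> x)\<^sup>2) =
      \<sigma> powr (2 * r) * (gauss_abs_moment (2 * r) / m\<^sup>2 - 2 / m * m + 1)"
    unfolding sq using i1 i2 N.prob_space
    by (simp add: gauss_abs_moment_def[symmetric] m_def)
  then show e: "(LINT x|std_normal_distribution. (centred_power r \<sigma> x)\<^sup>2) =
      \<sigma> powr (2 * r) * (gauss_abs_moment (2 * r) / (gauss_abs_moment r)\<^sup>2 - 1)"
    using m by (simp add: m_def)
  have "(LINT x|std_normal_distribution. (centred_power r \<sigma> x)\<^sup>2) \<noteq> 0"
  proof
    assume "(LINT x|std_normal_distribution. (centred_power r \<sigma> x)\<^sup>2) = 0"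
    then have "AE x in std_normal_distribution. (centred_power r \<sigma> x)\<^sup>2 = 0"
      by (subst (asm) integral_nonneg_eq_0_iff_AE[OF i]) auto
    then have "AE x in lborel. (centred_power r \<sigma> x)\<^sup>2 = 0"
      by (subst (asm) AE_density) (auto simp: normal_density_pos)
    then have "AE x in lborel. \<bar>x\<bar> = m powr (1 / r)"
    proof eventually_elim
      case (elim x)
      then have "\<bar>x\<bar> powr r = m"
        using assms m by (simp add: centred_power_def m_def)
      then show ?case using assms by (auto simp: powr_powr)
    qed
    then have "AE x in lborel. (x::real) = m powr (1 / r) \<or> x = - (m powr (1 / r))"
      by eventually_elim auto
    then have "AE x in lborel :: real measure. False"
      using AE_lborel_singleton[of "m powr (1 / r)"] AE_lborel_singleton[of "- (m powr (1 / r))"]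
      by eventually_elim simp
    then show False by (simp add: eventually_False ae_filter_eq_bot_iff)
  qed
  moreover have "0 \<le> (LINT x|std_normal_distribution. (centred_power r \<sigma> x)\<^sup>2)"
    by (intro Bochner_Integration.integral_nonneg) auto
  ultimately show "0 < \<sigma> powr (2 * r) * (gauss_abs_moment (2 * r) / (gauss_abs_moment r)\<^sup>2 - 1)"
    using e by linarith
qed

lemma normal_law_eq_distr:
  assumes "0 < v"
  shows "normal_law \<mu> v = distr std_normal_distribution borel (\<lambda>x. \<mu> + sqrt v * x)"
proof -
  interpret N: real_distribution std_normal_distribution by (rule real_dist_normal_dist)
  have "distributed std_normal_distribution lborel (\<lambda>x. x) std_normal_density"
    unfolding distributed_def by (auto simp: distr_id2)
  from N.normal_density_affine[OF this, of "sqrt v" \<mu>] assms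
  have "distributed std_normal_distribution lborel (\<lambda>x. \<mu> + sqrt v * x) (normal_density \<mu> (sqrt v))"
    by simp
  then have "distr std_normal_distribution lborel (\<lambda>x. \<mu> + sqrt v * x) = normal_law \<mu> v"
    unfolding normal_law_def by (rule distributed_distr_eq_density)
  moreover have "distr std_normal_distribution lborel (\<lambda>x. \<mu> + sqrt v * x)
      = distr std_normal_distribution borel (\<lambda>x. \<mu> + sqrt v * x)"
    by (rule distr_cong) auto
  ultimately show ?thesis by simp
qed

lemma char_affine_std_normal:
  "char (distr std_normal_distribution borel (\<lambda>x. m + s * x)) u = iexp (u * m) * exp (- (s * u)\<^sup>2 / 2)"
proof -
  interpret N: real_distribution std_normal_distribution by (rule real_dist_normal_dist)
  have "char (distr std_normal_distribution borel (\<lambda>x. m + s * x)) u =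
     (CLINT x|std_normal_distribution. iexp (u * m) * iexp ((s * u) * x))"
    unfolding char_def by (subst integral_distr) (auto simp: algebra_simps exp_add)
  also have "\<dots> = iexp (u * m) * char std_normal_distribution (s * u)"
    unfolding char_def by simp
  finally show ?thesis by (simp add: char_std_normal_distribution)
qed

lemma real_distribution_normal_law: "0 < v \<Longrightarrow> real_distribution (normal_law \<mu> v)"
  by (subst normal_law_eq_distr)
    (auto intro!: prob_space.real_distribution_distr real_distribution.axioms(1) real_dist_normal_dist)

lemma char_normal_law: "0 < v \<Longrightarrow> char (normal_law 0 v) u = exp (- (v * u\<^sup>2 / 2))"
  using char_affine_std_normal[of 0 "sqrt v" u] by (simp add: normal_law_eq_distr power_mult_distrib)

text \<open>
  The classical central limit theorem in terms of characteristic functions: in this form it can be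
  compared with triangular arrays, whose law changes from row to row, without constructing the two
  on a common probability space. The third order bound on the characteristic function shows that
  \<open>n (char \<mu> (u / \<surd>n) - 1)\<close> converges to \<open>- v u\<^sup>2 / 2\<close>.
\<close>
lemma char_power_tendsto_normal:
  assumes "real_distribution \<mu>"
    and i1: "integrable \<mu> (\<lambda>x. x)" and m0: "(LINT x|\<mu>. x) = 0"
    and i2: "integrable \<mu> (\<lambda>x. x\<^sup>2)" and v: "(LINT x|\<mu>. x\<^sup>2) = v"
  shows "(\<lambda>n. char \<mu> (u / sqrt (real n)) ^ n) \<longlonglongrightarrow> exp (- (v * u\<^sup>2 / 2))"
proof (rule LIMSEQ_imp_Suc)
  interpret real_distribution \<mu> by fact
  define z where "z n = of_nat (Suc n) * (char \<mu> (u / sqrt (real (Suc n))) - 1)" for n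
  define R where "R n = (LINT x|\<mu>. min (6 * x\<^sup>2) (\<bar>u / sqrt (real (Suc n))\<bar> * \<bar>x\<bar> ^ 3))" for n
  have R: "R \<longlonglongrightarrow> (LINT x|\<mu>. 0)"
    unfolding R_def
  proof (rule integral_dominated_convergence[where w="\<lambda>x. 6 * x\<^sup>2"])
    have "(\<lambda>n. \<bar>u\<bar> * sqrt (1 / real (Suc n))) \<longlonglongrightarrow> \<bar>u\<bar> * sqrt 0"
      by (intro tendsto_intros LIMSEQ_Suc[OF lim_1_over_n])
    then have "(\<lambda>n. \<bar>u / sqrt (real (Suc n))\<bar>) \<longlonglongrightarrow> 0"
      by (simp add: real_sqrt_divide)
    then have "(\<lambda>n. min (6 * x\<^sup>2) (\<bar>u / sqrt (real (Suc n))\<bar> * \<bar>x\<bar> ^ 3)) \<longlonglongrightarrow> min (6 * x\<^sup>2) (0 * \<bar>x\<bar> ^ 3)" for x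
      by (intro tendsto_intros)
    then show "AE x in \<mu>. (\<lambda>n. min (6 * x\<^sup>2) (\<bar>u / sqrt (real (Suc n))\<bar> * \<bar>x\<bar> ^ 3)) \<longlonglongrightarrow> 0"
      by simp
    show "integrable \<mu> (\<lambda>x. 6 * x\<^sup>2)" using i2 by simp
  qed auto
  have bound: "cmod (z n - (- (v * u\<^sup>2 / 2))) \<le> u\<^sup>2 / 6 * R n" for n
  proof -
    let ?t = "u / sqrt (real (Suc n))"
    have t2: "?t\<^sup>2 = u\<^sup>2 / real (Suc n)" by (simp add: power_divide)
    have "cmod (char \<mu> ?t - (1 - ?t\<^sup>2 * v / 2)) \<le> ?t\<^sup>2 / 6 * R n"
      unfolding R_def by (rule char_approx3) (use i1 i2 m0 v in auto)
    then have "real (Suc n) * cmod (char \<mu> ?t - (1 - ?t\<^sup>2 * v / 2)) \<le> real (Suc n) * (?t\<^sup>2 / 6 * R n)"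
      by (rule mult_left_mono) simp
    moreover have "real (Suc n) * cmod (char \<mu> ?t - (1 - ?t\<^sup>2 * v / 2)) =
        cmod (of_nat (Suc n) * (char \<mu> ?t - (1 - ?t\<^sup>2 * v / 2)))"
      by (simp only: norm_mult norm_of_nat)
    moreover have "of_nat (Suc n) * (char \<mu> ?t - (1 - complex_of_real (?t\<^sup>2 * v / 2))) = z n - (- (v * u\<^sup>2 / 2))"
      unfolding z_def t2 by (simp add: algebra_simps add_divide_distrib del: of_nat_Suc)
    ultimately show ?thesis by (simp add: t2 del: of_nat_Suc)
  qed
  have "(\<lambda>n. u\<^sup>2 / 6 * R n) \<longlonglongrightarrow> u\<^sup>2 / 6 * 0"
    using R by (intro tendsto_mult_left) simp
  then have "(\<lambda>n. z n - (- (v * u\<^sup>2 / 2))) \<longlonglongrightarrow> 0"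
    by (intro Lim_null_comparison[OF always_eventually, OF allI, OF bound]) simp
  then have z: "z \<longlonglongrightarrow> - (v * u\<^sup>2 / 2)" by (rule LIM_zero_cancel)
  have e: "1 + z n / of_nat (Suc n) = char \<mu> (u / sqrt (real (Suc n)))" for n
    unfolding z_def by (simp del: of_nat_Suc)
  from one_plus_div_power_tendsto_exp[OF z]
  show "(\<lambda>n. char \<mu> (u / sqrt (real (Suc n))) ^ Suc n) \<longlonglongrightarrow> exp (- (v * u\<^sup>2 / 2))"
    unfolding e using cmod_char_le_1 by (simp del: of_nat_Suc power_Suc add: exp_of_real[symmetric])
qed

section \<open>Even functions feel a small drift only to second order\<close>

text \<open>The linear terms cancel; this is the source of the second order in \<open>even_gaussian_shift\<close>.\<close>
lemma exp_plus_exp_minus_le: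
  fixes z :: real
  shows "\<bar>exp z + exp (- z) - 2\<bar> \<le> 2 * z\<^sup>2 * exp \<bar>z\<bar>"
proof -
  have *: "\<bar>exp y - (1 + y)\<bar> \<le> exp \<bar>y\<bar> * y\<^sup>2" for y :: real
  proof -
    have "exp (complex_of_real y) - (1 + complex_of_real y) = complex_of_real (exp y - (1 + y))"
      by (simp add: exp_of_real)
    then have "cmod (exp (complex_of_real y) - (1 + complex_of_real y)) = \<bar>exp y - (1 + y)\<bar>"
      by (simp only: norm_of_real real_norm_def)
    then show ?thesis using Taylor_exp[of "complex_of_real y" 1] by (simp add: power2_eq_square abs_mult[symmetric])
  qed
  define K where "K = exp \<bar>z\<bar> * z\<^sup>2"
  have "2 * z\<^sup>2 * exp \<bar>z\<bar> = 2 * K" by (simp add: K_def)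
  with *[of z] *[of "- z"] show ?thesis
    unfolding abs_minus_cancel power2_minus K_def[symmetric] abs_le_iff by linarith
qed

lemma std_normal_density_shift:
  "std_normal_density (x - a) = std_normal_density x * (exp (a * x) * exp (- a\<^sup>2 / 2))"
proof -
  have "- (x - a)\<^sup>2 / 2 = - x\<^sup>2 / 2 + (a * x + - a\<^sup>2 / 2)"
    by (simp add: power2_eq_square field_simps)
  then show ?thesis unfolding std_normal_density_def by (simp only: exp_add mult.assoc)
qed

text \<open>
  The factor \<open>exp |y|\<close> only shifts the normal density by \<open>\<plusminus>1\<close>, up to a constant, so that
  integrability follows from the fourth moments of two shifted normal laws.
\<close>
lemma integrable_exp_poly_std_normal:
  assumes "0 \<le> r" "r \<le> 2"
  shows "integrable lborel (\<lambda>y. \<bar>y\<bar> powr r * (1 + y\<^sup>2) * exp \<bar>y\<bar> * std_normal_density y)"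
proof -
  define W where "W y = exp (1 / 2) * ((18 * normal_density 1 1 y + 16 * (normal_density 1 1 y * (y - 1) ^ 4))
     + (18 * normal_density (-1) 1 y + 16 * (normal_density (-1) 1 y * (y - (-1)) ^ 4)))" for y :: real
  have bound: "norm (\<bar>y\<bar> powr r * (1 + y\<^sup>2) * exp \<bar>y\<bar> * std_normal_density y) \<le> norm (W y)" for y
  proof -
    have q: "z ^ 4 \<le> 8 * ((z - c) ^ 4 + 1)" if "c = 1 \<or> c = - 1" for z c :: real
    proof -
      have sq: "(p + q)\<^sup>2 \<le> 2 * p\<^sup>2 + 2 * q\<^sup>2" for p q :: real
        using zero_le_power2[of "p - q"] by (simp add: power2_eq_square algebra_simps)
      have "z\<^sup>2 \<le> 2 * (z - c)\<^sup>2 + 2"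
        using sq[of "z - c" c] that by auto
      then have "(z\<^sup>2)\<^sup>2 \<le> (2 * (z - c)\<^sup>2 + 2)\<^sup>2" by (intro power_mono) auto
      also have "\<dots> \<le> 2 * (2 * (z - c)\<^sup>2)\<^sup>2 + 2 * 2\<^sup>2" by (rule sq)
      finally show ?thesis by (simp add: power_mult_distrib)
    qed
    have p: "\<bar>y\<bar> powr r * (1 + y\<^sup>2) \<le> 2 + 2 * y ^ 4"
    proof -
      have "\<bar>y\<bar> powr r * (1 + y\<^sup>2) \<le> (1 + y\<^sup>2) * (1 + y\<^sup>2)"
        using powr_le_1_plus_sq[OF assms, of y] by (intro mult_right_mono) auto
      also have "\<dots> \<le> 2 + 2 * (y\<^sup>2)\<^sup>2"
        using zero_le_power2[of "1 - y\<^sup>2"] by (simp add: power2_eq_square algebra_simps)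
      finally show ?thesis by simp
    qed
    have p1: "\<bar>y\<bar> powr r * (1 + y\<^sup>2) \<le> 18 + 16 * (y - 1) ^ 4"
      using p q[of 1 y] by simp
    have p2: "\<bar>y\<bar> powr r * (1 + y\<^sup>2) \<le> 18 + 16 * (y - (-1)) ^ 4"
      using p q[of "-1" y] by simp
    have n1: "normal_density 1 1 y = std_normal_density y * (exp y * exp (- 1 / 2))"
      using std_normal_density_shift[of y 1] by (simp add: normal_density_def)
    have n2: "normal_density (-1) 1 y = std_normal_density y * (exp (- y) * exp (- 1 / 2))"
      using std_normal_density_shift[of y "-1"] by (simp add: normal_density_def)
    have h: "exp (1 / 2) * exp (- 1 / 2) = (1::real)" by (simp add: exp_add[symmetric])
    have W: "W y = (18 + 16 * (y - 1) ^ 4) * (exp y * std_normal_density y)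
        + (18 + 16 * (y - (-1)) ^ 4) * (exp (- y) * std_normal_density y)"
    proof -
      have "W y = (exp (1 / 2) * exp (- 1 / 2)) *
        ((18 + 16 * (y - 1) ^ 4) * (exp y * std_normal_density y)
        + (18 + 16 * (y - (-1)) ^ 4) * (exp (- y) * std_normal_density y))"
        unfolding W_def n1 n2 by (simp only: algebra_simps)
      then show ?thesis unfolding h by simp
    qed
    have nn: "0 \<le> (18 + 16 * (y - 1) ^ 4) * (exp y * std_normal_density y)"
      "0 \<le> (18 + 16 * (y - (-1)) ^ 4) * (exp (- y) * std_normal_density y)" by auto
    have "\<bar>y\<bar> powr r * (1 + y\<^sup>2) * (exp \<bar>y\<bar> * std_normal_density y) \<le> W y"
    proof (cases "0 \<le> y")
      case True
      then have "\<bar>y\<bar> powr r * (1 + y\<^sup>2) * (exp \<bar>y\<bar> * std_normal_density y)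
        \<le> (18 + 16 * (y - 1) ^ 4) * (exp y * std_normal_density y)"
        using p1 by (intro mult_mono) auto
      then show ?thesis using nn W by linarith
    next
      case False
      then have "\<bar>y\<bar> powr r * (1 + y\<^sup>2) * (exp \<bar>y\<bar> * std_normal_density y)
        \<le> (18 + 16 * (y - (-1)) ^ 4) * (exp (- y) * std_normal_density y)"
        using p2 by (intro mult_mono) auto
      then show ?thesis using nn W by linarith
    qed
    moreover have "0 \<le> \<bar>y\<bar> powr r * (1 + y\<^sup>2) * (exp \<bar>y\<bar> * std_normal_density y)" by auto
    ultimately show ?thesis by (simp only: mult.assoc real_norm_def)
  qed
  have "integrable lborel W"
    unfolding W_def
    by (intro integrable_mult_right Bochner_Integration.integrable_add integrable_normal_moment
        integrable_normal_density) auto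
  then show ?thesis
  proof (rule Bochner_Integration.integrable_bound, goal_cases)
    case 1
    show ?case by measurable
  next
    case 2
    show ?case by (intro AE_I2 bound)
  qed
qed

text \<open>
  Subadditivity bounds the effect of a drift \<open>a\<close> on \<open>|x|\<^sup>r\<close> only by \<open>|a|\<^sup>r\<close>, which is too weak: with \<open>a\<close> of order \<open>\<surd>\<Delta>\<close> it
  would require \<open>n \<Delta>\<^sup>r \<rightarrow> 0\<close>. Since \<open>f\<close> is even, shifting by \<open>a\<close> and by \<open>-a\<close> has the same
  effect, and averaging the two replaces the density \<open>\<phi>\<close> by
  \<open>\<phi>(y) exp (-a\<^sup>2 / 2) cosh (a y)\<close>, which differs from \<open>\<phi>(y)\<close> by \<open>O(a\<^sup>2)\<close>.
\<close>
lemma even_gaussian_shift: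
  assumes r: "0 \<le> r" "r \<le> 2"
  obtains C :: real where "0 \<le> C"
    "\<And>(f :: real \<Rightarrow> complex) T a. f \<in> borel_measurable borel \<Longrightarrow> (\<And>x. f (- x) = f x) \<Longrightarrow>
      (\<And>x. cmod (f x) \<le> T * \<bar>x\<bar> powr r) \<Longrightarrow> \<bar>a\<bar> \<le> 1 \<Longrightarrow>
      cmod ((CLINT x|std_normal_distribution. f (x + a)) - (CLINT x|std_normal_distribution. f x))
        \<le> T * C * a\<^sup>2"
proof -
  define D where "D y = \<bar>y\<bar> powr r * (1 + y\<^sup>2) * exp \<bar>y\<bar> * std_normal_density y" for y :: real
  have iD: "integrable lborel D" unfolding D_def using r by (rule integrable_exp_poly_std_normal)
  have D0: "0 \<le> D y" for y by (simp add: D_def)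
  define C where "C = integral\<^sup>L lborel D"
  have "0 \<le> C" unfolding C_def using D0 by (intro Bochner_Integration.integral_nonneg) auto
  moreover have "cmod ((CLINT x|std_normal_distribution. f (x + a)) - (CLINT x|std_normal_distribution. f x))
        \<le> T * C * a\<^sup>2"
    if f [measurable]: "f \<in> borel_measurable borel" and even: "\<And>x. f (- x) = f x"
      and fT: "\<And>x. cmod (f x) \<le> T * \<bar>x\<bar> powr r" and a: "\<bar>a\<bar> \<le> 1"
    for f :: "real \<Rightarrow> complex" and T a
  proof -
    have T: "0 \<le> T" using fT[of 1] norm_ge_zero[of "f 1"] by (simp del: norm_ge_zero)
    have q: "exp (c * y) * exp (- c\<^sup>2 / 2) \<le> exp \<bar>y\<bar>" if "\<bar>c\<bar> \<le> 1" for c y :: real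
    proof -
      have "\<bar>c * y\<bar> \<le> 1 * \<bar>y\<bar>" unfolding abs_mult using that by (intro mult_right_mono) auto
      then have "c * y + - c\<^sup>2 / 2 \<le> \<bar>y\<bar>" using zero_le_power2[of c] by linarith
      then show ?thesis by (simp only: exp_add[symmetric] exp_le_cancel_iff)
    qed
    have i: "integrable lborel (\<lambda>y. std_normal_density (y - c) *\<^sub>R f y)" if "\<bar>c\<bar> \<le> 1" for c
    proof (rule Bochner_Integration.integrable_bound[OF integrable_mult_right[OF iD, of T]])
      show "AE y in lborel. norm (std_normal_density (y - c) *\<^sub>R f y) \<le> norm (T * D y)"
      proof (rule AE_I2)
        fix y
        have "std_normal_density (y - c) * cmod (f y)
            \<le> (std_normal_density y * exp \<bar>y\<bar>) * (T * \<bar>y\<bar> powr r)"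
          unfolding std_normal_density_shift
          by (intro mult_mono mult_left_mono q[OF that] fT) (auto simp: T)
        also have "\<dots> = (T * \<bar>y\<bar> powr r * exp \<bar>y\<bar> * std_normal_density y) * 1" by simp
        also have "\<dots> \<le> (T * \<bar>y\<bar> powr r * exp \<bar>y\<bar> * std_normal_density y) * (1 + y\<^sup>2)"
          using T by (intro mult_left_mono) auto
        finally show "norm (std_normal_density (y - c) *\<^sub>R f y) \<le> norm (T * D y)"
          using T by (simp add: D_def mult_ac)
      qed
    qed measurable
    \<comment> \<open>Move the shift from the function to the density.\<close>
    define I where "I c = (CLINT y|lborel. std_normal_density (y - c) *\<^sub>R f y)" for c
    have I0: "(CLINT x|std_normal_distribution. f x) = I 0"
      unfolding I_def by (subst integral_density) auto
    have Ia: "(CLINT x|std_normal_distribution. f (x + a)) = I a"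
      unfolding I_def
      by (subst integral_density) (auto simp: lborel_integral_real_affine[where c=1 and t="- a", of "\<lambda>x. std_normal_density x *\<^sub>R f (x + a)"])
    have Ima: "I (- a) = I a"
      unfolding I_def
      by (subst lborel_integral_real_affine[where c="-1" and t=0])
        (auto simp: even std_normal_density_def power2_commute add.commute intro!: Bochner_Integration.integral_cong)
    define F where "F y = (std_normal_density (y - a) *\<^sub>R f y + std_normal_density (y - (- a)) *\<^sub>R f y)
         - (std_normal_density (y - 0) *\<^sub>R f y + std_normal_density (y - 0) *\<^sub>R f y)" for y
    have "I a + I (- a) - (I 0 + I 0) = (CLINT y|lborel. (std_normal_density (y - a) *\<^sub>R f y + std_normal_density (y - (- a)) *\<^sub>R f y)
         - (std_normal_density (y - 0) *\<^sub>R f y + std_normal_density (y - 0) *\<^sub>R f y))"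
      unfolding I_def using i[of a] i[of "- a"] i[of 0] a
      by (simp only: Bochner_Integration.integral_add Bochner_Integration.integral_diff
          Bochner_Integration.integrable_add abs_minus_cancel abs_zero zero_le_one simp_thms)
    then have IF: "2 * (I a - I 0) = integral\<^sup>L lborel F" using Ima by (simp add: F_def[abs_def])
    have "cmod (integral\<^sup>L lborel F) \<le> (LINT y|lborel. 2 * T * a\<^sup>2 * D y)"
    proof (rule Bochner_Integration.integral_norm_bound_integral)
      show "integrable lborel F" unfolding F_def
        by (intro Bochner_Integration.integrable_diff Bochner_Integration.integrable_add i) (use a in auto)
      show "integrable lborel (\<lambda>y. 2 * T * a\<^sup>2 * D y)" using iD by (rule integrable_mult_right)
      fix y
      define k where "k = exp (- a\<^sup>2 / 2)"
      define E where "E = exp (a * y) + exp (- (a * y))"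
      have k: "0 \<le> k" "k \<le> 1" "1 - k \<le> a\<^sup>2 / 2"
        using exp_ge_add_one_self[of "- a\<^sup>2 / 2"] by (auto simp: k_def)
      have ay: "\<bar>a * y\<bar> \<le> \<bar>y\<bar>" unfolding abs_mult using a by (simp add: mult_left_le_one_le)
      have "\<bar>E - 2\<bar> \<le> 2 * (a * y)\<^sup>2 * exp \<bar>a * y\<bar>" unfolding E_def by (rule exp_plus_exp_minus_le)
      also have "\<dots> \<le> 2 * (a * y)\<^sup>2 * exp \<bar>y\<bar>" using ay by (intro mult_left_mono) auto
      finally have E: "\<bar>E - 2\<bar> \<le> 2 * (a * y)\<^sup>2 * exp \<bar>y\<bar>" .
      have "k * E - 2 = k * (E - 2) - 2 * (1 - k)" by (simp add: algebra_simps)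
      then have "\<bar>k * E - 2\<bar> \<le> \<bar>k * (E - 2)\<bar> + \<bar>2 * (1 - k)\<bar>"
        by (simp only: abs_triangle_ineq4)
      also have "\<dots> = \<bar>k * (E - 2)\<bar> + 2 * (1 - k)" using k by simp
      also have "\<dots> \<le> 2 * (a * y)\<^sup>2 * exp \<bar>y\<bar> + a\<^sup>2"
      proof -
        have "\<bar>k * (E - 2)\<bar> \<le> 1 * (2 * (a * y)\<^sup>2 * exp \<bar>y\<bar>)"
          unfolding abs_mult using k E by (intro mult_mono) auto
        then show ?thesis using k by simp
      qed
      also have "\<dots> \<le> 2 * (a * y)\<^sup>2 * exp \<bar>y\<bar> + a\<^sup>2 * (2 * exp \<bar>y\<bar>)"
      proof -
        have "1 \<le> 2 * exp \<bar>y\<bar>" using exp_ge_add_one_self[of "\<bar>y\<bar>"] by linarith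
        then have "a\<^sup>2 * 1 \<le> a\<^sup>2 * (2 * exp \<bar>y\<bar>)" by (intro mult_left_mono) auto
        then show ?thesis by simp
      qed
      also have "\<dots> = 2 * a\<^sup>2 * ((1 + y\<^sup>2) * exp \<bar>y\<bar>)" by (simp add: power_mult_distrib algebra_simps)
      finally have kE: "\<bar>k * E - 2\<bar> \<le> 2 * a\<^sup>2 * ((1 + y\<^sup>2) * exp \<bar>y\<bar>)" .
      have Fy: "F y = (std_normal_density y * (k * E - 2)) *\<^sub>R f y"
      proof -
        have s: "std_normal_density (y - a) = std_normal_density y * (exp (a * y) * k)"
          "std_normal_density (y - (- a)) = std_normal_density y * (exp (- (a * y)) * k)"
          using std_normal_density_shift[of y a] std_normal_density_shift[of y "- a"] by (simp_all add: k_def)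
        show ?thesis
          unfolding F_def s E_def by (simp add: scaleR_conv_of_real ring_distribs mult_ac)
      qed
      have "norm (F y) = std_normal_density y * (\<bar>k * E - 2\<bar> * cmod (f y))"
        unfolding Fy by (simp add: abs_mult)
      also have "\<dots> \<le> std_normal_density y * ((2 * a\<^sup>2 * ((1 + y\<^sup>2) * exp \<bar>y\<bar>)) * (T * \<bar>y\<bar> powr r))"
        by (intro mult_left_mono mult_mono kE fT) auto
      also have "\<dots> = 2 * T * a\<^sup>2 * D y" by (simp add: D_def mult_ac)
      finally show "norm (F y) \<le> 2 * T * a\<^sup>2 * D y" .
    qed
    then have "cmod (2 * (I a - I 0)) \<le> (LINT y|lborel. 2 * T * a\<^sup>2 * D y)" by (simp only: IF)
    moreover have "cmod (2 * (I a - I 0)) = 2 * cmod (I a - I 0)" unfolding norm_mult by simp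
    moreover have "(LINT y|lborel. 2 * T * a\<^sup>2 * D y) = 2 * T * a\<^sup>2 * C"
      unfolding C_def by (rule integral_mult_right_zero)
    moreover have "2 * T * a\<^sup>2 * C = 2 * (T * C * a\<^sup>2)" by (simp only: mult_ac)
    ultimately have "cmod (I a - I 0) \<le> T * C * a\<^sup>2" by linarith
    then show ?thesis unfolding I0 Ia .
  qed
  ultimately show thesis by (rule that)
qed

section \<open>The delta method\<close>

text \<open>
  Skorohod's theorem turns weak convergence into pointwise convergence of variables \<open>Y\<^sub>n\<close> with the
  same laws. Pointwise, \<open>\<surd>n (h (\<theta> + Y\<^sub>n / \<surd>n) - h \<theta>)\<close> converges by differentiability of \<open>h\<close> at
  \<open>\<theta>\<close> alone, and bounded convergence takes this back to characteristic functions.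
\<close>
lemma delta_method:
  fixes T :: "nat \<Rightarrow> 'a \<Rightarrow> real" and h :: "real \<Rightarrow> real"
  assumes "prob_space M" and T [measurable]: "\<And>n. T n \<in> borel_measurable M"
    and h [measurable]: "h \<in> borel_measurable borel"
    and deriv: "(h has_real_derivative D) (at \<theta>)"
    and N: "real_distribution N"
    and conv: "weak_conv_m (\<lambda>n. distr M borel (\<lambda>\<omega>. sqrt (real n) * (T n \<omega> - \<theta>))) N"
  shows "weak_conv_m (\<lambda>n. distr M borel (\<lambda>\<omega>. sqrt (real n) * (h (T n \<omega>) - h \<theta>)))
    (distr N borel (\<lambda>x. D * x))"
proof -
  interpret prob_space M by fact
  interpret N: real_distribution N by fact
  let ?\<mu> = "\<lambda>n. distr M borel (\<lambda>\<omega>. sqrt (real n) * (T n \<omega> - \<theta>))"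
  have \<mu>: "real_distribution (?\<mu> n)" for n by simp
  from Skorohod[OF \<mu> N conv] obtain \<Omega> :: "real measure" and Y Y\<^sub>0 where Y: "prob_space \<Omega>"
    "\<And>n. Y n \<in> borel_measurable \<Omega>" "\<And>n. distr \<Omega> borel (Y n) = ?\<mu> n"
    "Y\<^sub>0 \<in> borel_measurable \<Omega>" "distr \<Omega> borel Y\<^sub>0 = N"
    "\<And>x. x \<in> space \<Omega> \<Longrightarrow> (\<lambda>n. Y n x) \<longlonglongrightarrow> Y\<^sub>0 x" by force
  note [measurable] = Y(2,4)
  interpret \<Omega>: prob_space \<Omega> by (rule Y(1))
  define \<tau> where "\<tau> n s = sqrt (real n) * (h (\<theta> + s / sqrt (real n)) - h \<theta>)" for n :: nat and s
  have [measurable]: "\<tau> n \<in> borel_measurable borel" for n unfolding \<tau>_def by measurable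
  have lim: "(\<lambda>n. \<tau> n (Y n x)) \<longlonglongrightarrow> D * Y\<^sub>0 x" if x: "x \<in> space \<Omega>" for x
  proof -
    obtain g where g: "\<And>z. h z - h \<theta> = g z * (z - \<theta>)" "isCont g \<theta>" "g \<theta> = D"
      using deriv unfolding CARAT_DERIV by auto
    have "(\<lambda>n. 1 / sqrt (real n)) \<longlonglongrightarrow> 0"
      using tendsto_real_sqrt[OF lim_1_over_n] by (simp add: real_sqrt_divide)
    then have "(\<lambda>n. \<theta> + Y n x * (1 / sqrt (real n))) \<longlonglongrightarrow> \<theta> + Y\<^sub>0 x * 0"
      by (intro tendsto_intros Y(6)[OF x])
    then have "(\<lambda>n. g (\<theta> + Y n x / sqrt (real n))) \<longlonglongrightarrow> g \<theta>"
      by (intro isCont_tendsto_compose[OF g(2)]) simp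
    then have "(\<lambda>n. g (\<theta> + Y n x / sqrt (real n)) * Y n x) \<longlonglongrightarrow> D * Y\<^sub>0 x"
      using Y(6)[OF x] g(3) by (auto intro: tendsto_mult)
    moreover have "\<forall>\<^sub>F n in sequentially. g (\<theta> + Y n x / sqrt (real n)) * Y n x = \<tau> n (Y n x)"
      by (rule eventually_sequentiallyI[of 1]) (simp add: \<tau>_def g(1))
    ultimately show ?thesis by (rule Lim_transform_eventually)
  qed
  have eq: "char (distr M borel (\<lambda>\<omega>. sqrt (real n) * (h (T n \<omega>) - h \<theta>))) u
      = (CLINT x|\<Omega>. iexp (u * \<tau> n (Y n x)))" for n u
  proof -
    have "(CLINT x|\<Omega>. iexp (u * \<tau> n (Y n x))) = (CLINT s|?\<mu> n. iexp (u * \<tau> n s))"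
      by (subst Y(3)[symmetric]) (simp add: integral_distr)
    also have "\<dots> = (CLINT \<omega>|M. iexp (u * \<tau> n (sqrt (real n) * (T n \<omega> - \<theta>))))"
      by (simp add: integral_distr)
    also have "\<dots> = (CLINT \<omega>|M. iexp (u * (sqrt (real n) * (h (T n \<omega>) - h \<theta>))))"
      by (intro Bochner_Integration.integral_cong) (auto simp: \<tau>_def)
    finally show ?thesis unfolding char_def by (simp add: integral_distr)
  qed
  show ?thesis
  proof (rule levy_continuity)
    show "real_distribution (distr N borel (\<lambda>x. D * x))" by simp
    fix u
    have "(\<lambda>n. CLINT x|\<Omega>. iexp (u * \<tau> n (Y n x))) \<longlonglongrightarrow> (CLINT x|\<Omega>. iexp (u * (D * Y\<^sub>0 x)))"
    proof (rule integral_dominated_convergence[where w="\<lambda>_. 1"])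
      show "AE x in \<Omega>. (\<lambda>n. iexp (u * \<tau> n (Y n x))) \<longlonglongrightarrow> iexp (u * (D * Y\<^sub>0 x))"
        by (intro AE_I2 isCont_tendsto_compose[OF isCont_iexp] tendsto_mult_left lim)
    qed auto
    also have "(CLINT x|\<Omega>. iexp (u * (D * Y\<^sub>0 x))) = char (distr N borel (\<lambda>x. D * x)) u"
      unfolding char_def by (simp add: integral_distr Y(5)[symmetric])
    finally show "(\<lambda>n. char (distr M borel (\<lambda>\<omega>. sqrt (real n) * (h (T n \<omega>) - h \<theta>))) u)
        \<longlonglongrightarrow> char (distr N borel (\<lambda>x. D * x)) u"
      unfolding eq .
  qed simp
qed

section \<open>The estimation error as an average of identically distributed terms\<close>

lemma (in prob_space) char_iid_average:
  assumes indep: "indep_vars (\<lambda>_. borel) Z {..<n}"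
    and law: "\<And>k. k < n \<Longrightarrow> distr M borel (Z k) = Q"
    and h [measurable]: "h \<in> borel_measurable borel"
  shows "char (distr M borel (\<lambda>\<omega>. \<Sum>k<n. h (Z k \<omega>) / sqrt (real n))) u =
    (CLINT x|Q. iexp (u / sqrt (real n) * h x)) ^ n"
proof -
  have [measurable]: "Z k \<in> borel_measurable M" if "k < n" for k
    using indep that unfolding indep_vars_def by auto
  have "char (distr M borel (\<lambda>\<omega>. \<Sum>k<n. h (Z k \<omega>) / sqrt (real n))) u
      = (\<Prod>k<n. char (distr M borel (\<lambda>\<omega>. h (Z k \<omega>) / sqrt (real n))) u)"
    by (rule char_distr_sum) (rule indep_vars_compose2[OF indep], measurable)
  also have "\<dots> = (\<Prod>k<n. CLINT x|Q. iexp (u / sqrt (real n) * h x))"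
  proof (rule prod.cong)
    fix k assume "k \<in> {..<n}"
    then have k: "k < n" by simp
    show "char (distr M borel (\<lambda>\<omega>. h (Z k \<omega>) / sqrt (real n))) u
        = (CLINT x|Q. iexp (u / sqrt (real n) * h x))"
      unfolding char_def law[OF k, symmetric] using k
      by (subst (1 2) integral_distr) auto
  qed simp
  finally show ?thesis by simp
qed

text \<open>The contribution of one increment \<open>x\<close> over a time step \<open>\<delta>\<close> to the estimation error.\<close>
definition rescaled_power_error :: "real \<Rightarrow> real \<Rightarrow> real \<Rightarrow> real \<Rightarrow> real" where
  "rescaled_power_error r \<sigma> \<delta> x = \<bar>x\<bar> powr r / (gauss_abs_moment r * \<delta> powr (r / 2)) - \<sigma> powr r"

lemma rescaled_power_error_measurable [measurable]:
  "rescaled_power_error r \<sigma> \<delta> \<in> borel_measurable borel"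
  unfolding rescaled_power_error_def by measurable

lemma rescaled_power_error_diff_le:
  assumes "0 < r" "r \<le> 1" "0 < \<delta>"
  shows "\<bar>rescaled_power_error r \<sigma> \<delta> x - rescaled_power_error r \<sigma> \<delta> y\<bar>
    \<le> \<bar>x - y\<bar> powr r / (gauss_abs_moment r * \<delta> powr (r / 2))"
proof -
  have "0 < gauss_abs_moment r * \<delta> powr (r / 2)"
    using gauss_abs_moment_pos[of r] assms by simp
  then show ?thesis
    using abs_powr_diff_le[of r x y] assms
    by (simp add: rescaled_power_error_def diff_divide_distrib[symmetric] divide_right_mono)
qed

lemma power_variation_error_eq_sum:
  assumes "0 < n" "0 < \<delta>"
  shows "sqrt (real n) * (power_variation_estimator L \<delta> r n \<omega> - \<sigma> powr r) =
    (\<Sum>k<n. rescaled_power_error r \<sigma> \<delta> (L (real (Suc k) * \<delta>) \<omega> - L (real k * \<delta>) \<omega>) / sqrt (real n))"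
proof -
  define c where "c = gauss_abs_moment r * \<delta> powr (r / 2)"
  define S where "S = (\<Sum>k<n. \<bar>L (real (Suc k) * \<delta>) \<omega> - L (real k * \<delta>) \<omega>\<bar> powr r)"
  have "(\<Sum>k=1..n. \<bar>L (real k * \<delta>) \<omega> - L ((real k - 1) * \<delta>) \<omega>\<bar> powr r) = S"
    unfolding S_def by (rule sum.reindex_bij_witness[of _ Suc "\<lambda>k. k - 1"]) auto
  then have e1: "power_variation_estimator L \<delta> r n \<omega> = S / c / real n"
    by (simp add: power_variation_estimator_def c_def)
  have e2: "(\<Sum>k<n. rescaled_power_error r \<sigma> \<delta> (L (real (Suc k) * \<delta>) \<omega> - L (real k * \<delta>) \<omega>) / sqrt (real n))
     = (S / c - real n * \<sigma> powr r) / sqrt (real n)"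
    unfolding rescaled_power_error_def c_def[symmetric] S_def
    by (simp add: sum_divide_distrib[symmetric] sum_subtractf)
  have e3: "sqrt (real n) * (a / real n - b) = (a - real n * b) / sqrt (real n)" for a b
    using assms by (simp add: field_simps)
  show ?thesis unfolding e1 e2 e3 ..
qed

lemma real_distribution_affine_std_normal:
  "real_distribution (distr std_normal_distribution borel (\<lambda>x. m + s * x))"
  by (auto intro!: prob_space.real_distribution_distr real_distribution.axioms(1) real_dist_normal_dist)

lemma cmod_integral_iexp_le_1:
  assumes "real_distribution Q"
  shows "cmod (CLINT x|Q. iexp (f x)) \<le> 1"
proof -
  interpret real_distribution Q by fact
  have "cmod (CLINT x|Q. iexp (f x)) \<le> (LINT x|Q. cmod (iexp (f x)))" by (rule integral_norm_bound)
  also have "\<dots> \<le> 1" by simp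
  finally show ?thesis .
qed

lemma sqrt_times_half_power_tendsto:
  assumes lim: "(\<lambda>n. real n * \<Delta> n powr a) \<longlonglongrightarrow> 0"
  shows "(\<lambda>n. sqrt (real n) * \<Delta> n powr (a / 2)) \<longlonglongrightarrow> 0"
proof -
  have "(\<lambda>n. sqrt (real n * \<Delta> n powr a)) \<longlonglongrightarrow> sqrt 0" using lim by (rule tendsto_real_sqrt)
  moreover have "sqrt (real n * \<Delta> n powr a) = sqrt (real n) * \<Delta> n powr (a / 2)" for n
    by (simp add: real_sqrt_mult powr_half_sqrt_powr[symmetric] powr_half_sqrt[symmetric] powr_powr)
  ultimately show ?thesis by simp
qed

text \<open>
  The theorem in the absence of jumps. Without the drift \<open>b\<close> all rows have the same standardised law,
  and this is the central limit theorem. In standardised units the drift is \<open>b \<surd>\<Delta> / \<sigma>\<close>, so by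
  \<open>even_gaussian_shift\<close> each of the \<open>n\<close> factors changes by \<open>O(\<Delta> / \<surd>n)\<close>, and their product by
  \<open>O(\<surd>n \<Delta>)\<close>.
\<close>
lemma gaussian_increments_char_tendsto:
  fixes \<Delta> :: "nat \<Rightarrow> real"
  assumes \<Delta>: "\<And>n. 0 < n \<Longrightarrow> 0 < \<Delta> n" and \<Delta>0: "\<Delta> \<longlonglongrightarrow> 0"
    and r: "0 < r" "r \<le> 1" and n\<Delta>: "(\<lambda>n. sqrt (real n) * \<Delta> n) \<longlonglongrightarrow> 0" and \<sigma>: "0 < \<sigma>"
  shows "(\<lambda>n. (CLINT x|distr std_normal_distribution borel (\<lambda>x. b * \<Delta> n + \<sigma> * sqrt (\<Delta> n) * x).
        iexp (u / sqrt (real n) * rescaled_power_error r \<sigma> (\<Delta> n) x)) ^ n)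
    \<longlonglongrightarrow> exp (- (\<sigma> powr (2 * r) * (gauss_abs_moment (2 * r) / (gauss_abs_moment r)\<^sup>2 - 1) * u\<^sup>2 / 2))"
    (is "(\<lambda>n. ?A n ^ n) \<longlonglongrightarrow> ?l")
proof -
  interpret N: real_distribution std_normal_distribution by (rule real_dist_normal_dist)
  define \<mu> where "\<mu> = distr std_normal_distribution borel (centred_power r \<sigma>)"
  have \<mu>: "real_distribution \<mu>" unfolding \<mu>_def by simp
  have B: "(\<lambda>n. char \<mu> (u / sqrt (real n)) ^ n) \<longlonglongrightarrow> ?l"
  proof (rule char_power_tendsto_normal[OF \<mu>])
    show "integrable \<mu> (\<lambda>x. x)" "(LINT x|\<mu>. x) = 0" "integrable \<mu> (\<lambda>x. x\<^sup>2)"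
      "(LINT x|\<mu>. x\<^sup>2) = \<sigma> powr (2 * r) * (gauss_abs_moment (2 * r) / (gauss_abs_moment r)\<^sup>2 - 1)"
      unfolding \<mu>_def using centred_power_moments[OF r \<sigma>]
      by (simp_all add: integrable_distr_eq integral_distr)
  qed
  define m where "m = gauss_abs_moment r"
  have m: "0 < m" unfolding m_def using r by (intro gauss_abs_moment_pos) auto
  obtain C where C: "0 \<le> C"
    "\<And>(f :: real \<Rightarrow> complex) T a. f \<in> borel_measurable borel \<Longrightarrow> (\<And>x. f (- x) = f x) \<Longrightarrow>
      (\<And>x. cmod (f x) \<le> T * \<bar>x\<bar> powr r) \<Longrightarrow> \<bar>a\<bar> \<le> 1 \<Longrightarrow>
      cmod ((CLINT x|std_normal_distribution. f (x + a)) - (CLINT x|std_normal_distribution. f x))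
        \<le> T * C * a\<^sup>2"
    by (rule even_gaussian_shift[of r]) (use r in auto)
  define a where "a n = b * sqrt (\<Delta> n) / \<sigma>" for n
  define K where "K = \<bar>u\<bar> * (\<sigma> powr r / m) * C * (b\<^sup>2 / \<sigma>\<^sup>2)"
  have A: "?A n = (CLINT x|std_normal_distribution. iexp (u / sqrt (real n) * centred_power r \<sigma> (x + a n)))"
    if "0 < n" for n
  proof -
    have "rescaled_power_error r \<sigma> (\<Delta> n) (b * \<Delta> n + \<sigma> * sqrt (\<Delta> n) * x) = centred_power r \<sigma> (x + a n)" for x
    proof -
      have d: "0 < \<Delta> n" using \<Delta> that .
      have "b * \<Delta> n + \<sigma> * sqrt (\<Delta> n) * x = \<sigma> * sqrt (\<Delta> n) * (x + a n)"
        using \<sigma> d real_sqrt_mult_self[of "\<Delta> n"] by (simp add: a_def algebra_simps)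
      then have "\<bar>b * \<Delta> n + \<sigma> * sqrt (\<Delta> n) * x\<bar> powr r = \<sigma> powr r * \<Delta> n powr (r / 2) * \<bar>x + a n\<bar> powr r"
        using \<sigma> d by (simp add: abs_mult powr_mult powr_half_sqrt[symmetric] powr_powr)
      then show ?thesis
        using d m by (simp add: rescaled_power_error_def centred_power_def m_def algebra_simps)
    qed
    then show ?thesis by (subst integral_distr) auto
  qed
  have D: "cmod (?A n ^ n - char \<mu> (u / sqrt (real n)) ^ n) \<le> K * (sqrt (real n) * \<Delta> n)"
    if n: "0 < n" and an: "\<bar>a n\<bar> \<le> 1" for n
  proof -
    define t where "t = u / sqrt (real n)"
    \<comment> \<open>Subtracting the value at 0 makes \<open>f\<close> of order \<open>|x|\<^sup>r\<close> with a factor \<open>t\<close>; the constant is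
        unaffected by the shift.\<close>
    define f where "f x = iexp (t * centred_power r \<sigma> x) - iexp (t * (- (\<sigma> powr r)))" for x
    have [measurable]: "f \<in> borel_measurable borel" unfolding f_def by measurable
    have i: "integrable std_normal_distribution (\<lambda>x. iexp (t * centred_power r \<sigma> (x + c)))" for c
      by (rule N.integrable_const_bound[of _ 1]) auto
    have F: "(CLINT x|std_normal_distribution. f (x + c)) =
        (CLINT x|std_normal_distribution. iexp (t * centred_power r \<sigma> (x + c))) - iexp (t * (- (\<sigma> powr r)))" for c
      unfolding f_def using N.prob_space by (subst Bochner_Integration.integral_diff[OF i]) simp_all
    have At: "?A n = (CLINT x|std_normal_distribution. iexp (t * centred_power r \<sigma> (x + a n)))"
      unfolding A[OF n] t_def ..
    have Bt: "char \<mu> t = (CLINT x|std_normal_distribution. iexp (t * centred_power r \<sigma> x))"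
      unfolding \<mu>_def char_def by (subst integral_distr) auto
    have FD: "?A n - char \<mu> t = (CLINT x|std_normal_distribution. f (x + a n)) - (CLINT x|std_normal_distribution. f x)"
      unfolding At Bt F F[of 0, unfolded add_0_right] by simp
    have "cmod ((CLINT x|std_normal_distribution. f (x + a n)) - (CLINT x|std_normal_distribution. f x))
        \<le> (\<bar>t\<bar> * (\<sigma> powr r / m)) * C * (a n)\<^sup>2"
    proof (rule C(2))
      show "f (- x) = f x" for x by (simp add: f_def centred_power_def)
      fix x
      have "cmod (f x) \<le> \<bar>t * centred_power r \<sigma> x - t * (- (\<sigma> powr r))\<bar>"
        unfolding f_def by (rule cmod_iexp_diff_le)
      also have "t * centred_power r \<sigma> x - t * (- (\<sigma> powr r)) = t * (\<sigma> powr r / m) * \<bar>x\<bar> powr r"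
        by (simp add: centred_power_def m_def algebra_simps)
      also have "\<bar>\<dots>\<bar> = \<bar>t\<bar> * (\<sigma> powr r / m) * \<bar>x\<bar> powr r"
        using m by (simp add: abs_mult)
      finally show "cmod (f x) \<le> \<bar>t\<bar> * (\<sigma> powr r / m) * \<bar>x\<bar> powr r" .
    qed (use an in auto)
    then have "cmod (?A n - char \<mu> t) \<le> (\<bar>t\<bar> * (\<sigma> powr r / m)) * C * (a n)\<^sup>2"
      unfolding FD .
    then have "real n * cmod (?A n - char \<mu> t) \<le> real n * ((\<bar>t\<bar> * (\<sigma> powr r / m)) * C * (a n)\<^sup>2)"
      by (rule mult_left_mono) simp
    also have "\<dots> = (real n * \<bar>t\<bar>) * (\<sigma> powr r / m) * C * (a n)\<^sup>2" by simp
    also have "real n * \<bar>t\<bar> = \<bar>u\<bar> * sqrt (real n)"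
      using n by (simp add: t_def abs_divide field_simps)
    also have "(a n)\<^sup>2 = b\<^sup>2 / \<sigma>\<^sup>2 * \<Delta> n"
      using \<Delta>[OF n] by (simp add: a_def power_divide power_mult_distrib)
    finally have "real n * cmod (?A n - char \<mu> t) \<le> K * (sqrt (real n) * \<Delta> n)"
      by (simp add: K_def mult_ac)
    moreover have "cmod (?A n ^ n - char \<mu> t ^ n) \<le> real n * cmod (?A n - char \<mu> t)"
      by (intro norm_power_diff cmod_integral_iexp_le_1 real_distribution_affine_std_normal
          real_distribution.cmod_char_le_1[OF \<mu>])
    ultimately show ?thesis unfolding t_def by linarith
  qed
  have "(\<lambda>n. b * sqrt (\<Delta> n) / \<sigma>) \<longlonglongrightarrow> b * sqrt 0 / \<sigma>"
    using \<sigma> by (intro tendsto_intros \<Delta>0) auto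
  then have "a \<longlonglongrightarrow> 0" by (simp add: a_def[abs_def])
  then have "\<forall>\<^sub>F n in sequentially. \<bar>a n\<bar> < 1"
    by (intro order_tendstoD(2)[of _ 0]) (auto intro: tendsto_rabs_zero)
  then have ev: "\<forall>\<^sub>F n in sequentially. cmod (?A n ^ n - char \<mu> (u / sqrt (real n)) ^ n) \<le> K * (sqrt (real n) * \<Delta> n)"
    using eventually_gt_at_top[of 0] by eventually_elim (use D in auto)
  have "(\<lambda>n. K * (sqrt (real n) * \<Delta> n)) \<longlonglongrightarrow> K * 0" using n\<Delta> by (rule tendsto_mult_left)
  then have "(\<lambda>n. ?A n ^ n - char \<mu> (u / sqrt (real n)) ^ n) \<longlonglongrightarrow> 0"
    using Lim_null_comparison[OF ev] by simp
  from tendsto_add[OF this B] show ?thesis by simp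
qed

section \<open>Levy processes with a density\<close>

lemma distr_minus_initial:
  assumes "levy_process M X" "0 \<le> t"
  shows "distr M borel (\<lambda>\<omega>. X t \<omega> - X 0 \<omega>) = distr M borel (X t)"
proof (rule distr_cong_AE)
  have [measurable]: "X t \<in> borel_measurable M" "X 0 \<in> borel_measurable M"
    using assms by (auto simp: levy_process_def real_process_def)
  show "(\<lambda>\<omega>. X t \<omega> - X 0 \<omega>) \<in> borel_measurable M" "X t \<in> borel_measurable M" by measurable
  have "AE \<omega> in M. X 0 \<omega> = 0" using assms by (simp add: levy_process_def)
  then show "AE \<omega> in M. X t \<omega> - X 0 \<omega> = X t \<omega>" by eventually_elim simp
qed auto

lemma distr_levy_increment:
  assumes X: "levy_process M X" and st: "0 \<le> s" "s \<le> t"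
  shows "distr M borel (\<lambda>\<omega>. X t \<omega> - X s \<omega>) = distr M borel (X (t - s))"
proof -
  have "stationary_increments M X" using X by (simp add: levy_process_def)
  then have "distr M borel (\<lambda>\<omega>. X (s + (t - s)) \<omega> - X s \<omega>)
      = distr M borel (\<lambda>\<omega>. X (t - s) \<omega> - X 0 \<omega>)"
    unfolding stationary_increments_def using st by (metis diff_ge_0_iff_ge)
  then show ?thesis using distr_minus_initial[OF X, of "t - s"] st by simp
qed

lemma indep_grid_increments:
  assumes "independent_increments M X" "0 \<le> \<delta>"
  shows "prob_space.indep_vars M (\<lambda>_. borel)
    (\<lambda>k \<omega>. X (real (Suc k) * \<delta>) \<omega> - X (real k * \<delta>) \<omega>) {..<n}"
proof -
  have "0 \<le> real 0 * \<delta> \<and> (\<forall>i<n. real i * \<delta> \<le> real (Suc i) * \<delta>)"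
    using assms(2) by (auto intro!: mult_right_mono)
  with assms(1) show ?thesis
    unfolding independent_increments_def by (elim allE[of _ "\<lambda>k. real k * \<delta>"]) blast
qed

lemma integrable_iexp_minus_1:
  fixes \<nu> :: "real \<Rightarrow> real"
  assumes [measurable]: "\<nu> \<in> borel_measurable borel" and nn: "\<And>x. 0 \<le> \<nu> x"
    and i: "integrable lborel (\<lambda>x. \<bar>x\<bar> * \<nu> x)"
  shows "integrable lborel (\<lambda>x. (iexp (u * x) - 1) * \<nu> x)"
proof (rule Bochner_Integration.integrable_bound[OF integrable_mult_right[OF i, of "\<bar>u\<bar>"]])
  show "AE x in lborel. norm ((iexp (u * x) - 1) * \<nu> x) \<le> norm (\<bar>u\<bar> * (\<bar>x\<bar> * \<nu> x))"
  proof (rule AE_I2)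
    fix x
    have "cmod (iexp (u * x) - 1) * \<nu> x \<le> \<bar>u * x\<bar> * \<nu> x"
      using cmod_iexp_diff_le[of "u * x" 0] nn by (intro mult_right_mono) auto
    then show "norm ((iexp (u * x) - 1) * \<nu> x) \<le> norm (\<bar>u\<bar> * (\<bar>x\<bar> * \<nu> x))"
      unfolding norm_mult using nn by (simp add: abs_mult mult.assoc)
  qed
qed measurable

text \<open>
  When \<open>|x| \<nu>(x)\<close> is integrable the compensator \<open>- i u x\<close> can be split off and merged with the
  drift. What remains are a Gaussian factor and the pure jump factor of \<open>integral_diff_le_jumps\<close>.
\<close>
lemma levy_density_char_factor:
  assumes L: "levy_process_with_density M L \<sigma> \<nu>"
    and i1: "integrable lborel (\<lambda>x. \<bar>x\<bar> * \<nu> x)" and t: "0 \<le> t"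
  shows "char (distr M borel (L t)) u =
    char (distr std_normal_distribution borel
      (\<lambda>x. (integral\<^sup>L M (L 1) - (LINT x|lborel. x * \<nu> x)) * t + \<sigma> * sqrt t * x)) u *
    exp (complex_of_real t * (CLINT x|lborel. (iexp (u * x) - 1) * \<nu> x))"
proof -
  have [measurable]: "\<nu> \<in> borel_measurable borel" and nn: "\<And>x. 0 \<le> \<nu> x"
    using L by (auto simp: levy_process_with_density_def)
  have ix: "integrable lborel (\<lambda>x. x * \<nu> x)"
    by (rule Bochner_Integration.integrable_bound[OF i1]) (auto simp: abs_mult nn)
  define m where "m = integral\<^sup>L M (L 1)"
  define \<kappa> where "\<kappa> = (LINT x|lborel. x * \<nu> x)"
  define \<psi> where "\<psi> = (CLINT x|lborel. (iexp (u * x) - 1) * \<nu> x)"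
  have "(CLINT x|lborel. (iexp (u * x) - 1 - \<i> * complex_of_real (u * x)) * complex_of_real (\<nu> x))
     = (CLINT x|lborel. (iexp (u * x) - 1) * \<nu> x - \<i> * complex_of_real u * complex_of_real (x * \<nu> x))"
    by (intro Bochner_Integration.integral_cong) (auto simp: algebra_simps)
  also have "\<dots> = \<psi> - (CLINT x|lborel. \<i> * complex_of_real u * complex_of_real (x * \<nu> x))"
    unfolding \<psi>_def using ix i1 nn
    by (intro Bochner_Integration.integral_diff integrable_iexp_minus_1 integrable_mult_right integrable_of_real) auto
  also have "(CLINT x|lborel. \<i> * complex_of_real u * complex_of_real (x * \<nu> x)) = \<i> * complex_of_real u * \<kappa>"
    unfolding \<kappa>_def by (simp only: integral_mult_right_zero integral_complex_of_real)
  finally have "char (distr M borel (L t)) u = exp (complex_of_real t *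
      (\<i> * complex_of_real u * m - complex_of_real (u\<^sup>2 * \<sigma>\<^sup>2 / 2) + (\<psi> - \<i> * complex_of_real u * \<kappa>)))"
    using L t by (simp add: levy_process_with_density_def m_def)
  also have "complex_of_real t *
      (\<i> * complex_of_real u * m - complex_of_real (u\<^sup>2 * \<sigma>\<^sup>2 / 2) + (\<psi> - \<i> * complex_of_real u * \<kappa>))
      = \<i> * complex_of_real (u * ((m - \<kappa>) * t)) + complex_of_real (- (\<sigma> * sqrt t * u)\<^sup>2 / 2) + complex_of_real t * \<psi>"
    using t by (simp add: power_mult_distrib) (simp add: algebra_simps)
  finally show ?thesis
    unfolding char_affine_std_normal m_def \<kappa>_def \<psi>_def by (simp only: exp_add exp_of_real)
qed

text \<open>
  The increments are independent and identically distributed, so the characteristic function of the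
  error is an \<open>n\<close>-th power, and it suffices to compare one factor with its Gaussian counterpart.
  The function \<open>iexp (u / \<surd>n * rescaled_power_error r \<sigma> \<Delta> x)\<close> is \<open>r\<close>-Hoelder with a constant
  proportional to \<open>n\<^sup>-\<^sup>1\<^sup>/\<^sup>2 \<Delta>\<^sup>-\<^sup>r\<^sup>/\<^sup>2\<close>, so the jumps cost \<open>O(n\<^sup>-\<^sup>1\<^sup>/\<^sup>2 \<Delta>\<^sup>1\<^sup>-\<^sup>r\<^sup>/\<^sup>2)\<close> per factor, and the whole
  product changes by \<open>O(\<surd>n \<Delta>\<^sup>1\<^sup>-\<^sup>r\<^sup>/\<^sup>2)\<close>, the square root of \<open>n \<Delta>\<^sup>2\<^sup>-\<^sup>r\<close>.
\<close>
lemma levy_case_char_tendsto: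
  assumes "prob_space M" and L: "levy_process_with_density M L \<sigma> \<nu>"
    and i1: "integrable lborel (\<lambda>x. \<bar>x\<bar> * \<nu> x)" and ir: "integrable lborel (\<lambda>x. \<bar>x\<bar> powr r * \<nu> x)"
    and \<Delta>: "\<And>n. 0 < n \<Longrightarrow> 0 < \<Delta> n" and \<Delta>0: "\<Delta> \<longlonglongrightarrow> 0" and r: "0 < r" "r \<le> 1" and \<sigma>: "0 < \<sigma>"
    and n\<Delta>: "(\<lambda>n. sqrt (real n) * \<Delta> n) \<longlonglongrightarrow> 0"
    and n\<Delta>r: "(\<lambda>n. sqrt (real n) * \<Delta> n powr (1 - r / 2)) \<longlonglongrightarrow> 0"
  shows "(\<lambda>n. char (distr M borel (\<lambda>\<omega>. sqrt (real n) *
        (power_variation_estimator L (\<Delta> n) r n \<omega> - \<sigma> powr r))) u)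
    \<longlonglongrightarrow> exp (- (\<sigma> powr (2 * r) * (gauss_abs_moment (2 * r) / (gauss_abs_moment r)\<^sup>2 - 1) * u\<^sup>2 / 2))"
    (is "?X \<longlonglongrightarrow> ?l")
proof -
  interpret prob_space M by fact
  have lp: "levy_process M L" and \<nu>[measurable]: "\<nu> \<in> borel_measurable borel" and nn: "\<And>x. 0 \<le> \<nu> x"
    using L by (auto simp: levy_process_with_density_def)
  have rv [measurable]: "L t \<in> borel_measurable M" if "0 \<le> t" for t
    using lp that by (auto simp: levy_process_def real_process_def)
  define b where "b = integral\<^sup>L M (L 1) - (LINT x|lborel. x * \<nu> x)"
  define Q where "Q n = distr M borel (L (\<Delta> n))" for n
  define G where "G n = distr std_normal_distribution borel (\<lambda>x. b * \<Delta> n + \<sigma> * sqrt (\<Delta> n) * x)" for n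
  define J where "J = (LINT x|lborel. \<bar>x\<bar> powr r * \<nu> x)"
  define m where "m = gauss_abs_moment r"
  have m: "0 < m" unfolding m_def using r by (intro gauss_abs_moment_pos) auto
  let ?A = "\<lambda>n Q. CLINT x|Q n. iexp (u / sqrt (real n) * rescaled_power_error r \<sigma> (\<Delta> n) x)"
  have G: "real_distribution (G n)" for n
    unfolding G_def by (rule real_distribution_affine_std_normal)
  have Q: "real_distribution (Q n)" if "0 < n" for n
    unfolding Q_def using \<Delta>[OF that] by (intro real_distribution_distr rv) simp
  have XQ: "?X n = ?A n Q ^ n" if n: "0 < n" for n
  proof -
    have d: "0 < \<Delta> n" using \<Delta> n .
    have "?X n = char (distr M borel (\<lambda>\<omega>. \<Sum>k<n. rescaled_power_error r \<sigma> (\<Delta> n)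
        (L (real (Suc k) * \<Delta> n) \<omega> - L (real k * \<Delta> n) \<omega>) / sqrt (real n))) u"
      unfolding power_variation_error_eq_sum[OF n d] ..
    also have "\<dots> = ?A n Q ^ n"
    proof (rule char_iid_average)
      show "indep_vars (\<lambda>_. borel) (\<lambda>k \<omega>. L (real (Suc k) * \<Delta> n) \<omega> - L (real k * \<Delta> n) \<omega>) {..<n}"
        using lp d by (intro indep_grid_increments) (auto simp: levy_process_def)
      fix k
      have "real (Suc k) * \<Delta> n - real k * \<Delta> n = \<Delta> n" by (simp add: algebra_simps)
      then show "distr M borel (\<lambda>\<omega>. L (real (Suc k) * \<Delta> n) \<omega> - L (real k * \<Delta> n) \<omega>) = Q n"
        unfolding Q_def using distr_levy_increment[OF lp, of "real k * \<Delta> n" "real (Suc k) * \<Delta> n"] d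
        by (simp add: algebra_simps)
    qed measurable
    finally show ?thesis .
  qed
  have bound: "cmod (?A n Q ^ n - ?A n G ^ n) \<le> \<bar>u\<bar> / m * J * (sqrt (real n) * \<Delta> n powr (1 - r / 2))"
    if n: "0 < n" for n
  proof -
    have d: "0 < \<Delta> n" using \<Delta> n .
    define t where "t = u / sqrt (real n)"
    have "norm ((CLINT x|Q n. iexp (t * rescaled_power_error r \<sigma> (\<Delta> n) x))
        - (CLINT x|G n. iexp (t * rescaled_power_error r \<sigma> (\<Delta> n) x)))
      \<le> (\<bar>t\<bar> / (m * \<Delta> n powr (r / 2))) * (\<Delta> n * J)"
      unfolding J_def
    proof (rule integral_diff_le_jumps[OF Q[OF n] G \<nu> nn r ir])
      show "char (Q n) v = char (G n) v * exp (complex_of_real (\<Delta> n) * (CLINT x|lborel. (iexp (v * x) - 1) * \<nu> x))" for v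
        unfolding Q_def G_def b_def using L i1 d by (intro levy_density_char_factor) auto
      show "isCont (\<lambda>x. iexp (t * rescaled_power_error r \<sigma> (\<Delta> n) x)) x" for x
        unfolding rescaled_power_error_def using r m d
        by (intro continuous_intros isCont_abs_powr) (auto simp: m_def)
      show "norm (iexp (t * rescaled_power_error r \<sigma> (\<Delta> n) x)) \<le> 1" for x by simp
      fix x y
      have "cmod (iexp (t * rescaled_power_error r \<sigma> (\<Delta> n) x) - iexp (t * rescaled_power_error r \<sigma> (\<Delta> n) y))
          \<le> \<bar>t * rescaled_power_error r \<sigma> (\<Delta> n) x - t * rescaled_power_error r \<sigma> (\<Delta> n) y\<bar>"
        by (rule cmod_iexp_diff_le)
      also have "\<dots> = \<bar>t\<bar> * \<bar>rescaled_power_error r \<sigma> (\<Delta> n) x - rescaled_power_error r \<sigma> (\<Delta> n) y\<bar>"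
        by (simp only: abs_mult[symmetric] right_diff_distrib)
      also have "\<dots> \<le> \<bar>t\<bar> * (\<bar>x - y\<bar> powr r / (gauss_abs_moment r * \<Delta> n powr (r / 2)))"
        using r d by (intro mult_left_mono rescaled_power_error_diff_le) auto
      finally show "norm (iexp (t * rescaled_power_error r \<sigma> (\<Delta> n) x) - iexp (t * rescaled_power_error r \<sigma> (\<Delta> n) y))
         \<le> \<bar>t\<bar> / (m * \<Delta> n powr (r / 2)) * \<bar>x - y\<bar> powr r"
        by (simp add: m_def)
    qed (use d in simp)
    then have "real n * cmod (?A n Q - ?A n G) \<le> real n * ((\<bar>t\<bar> / (m * \<Delta> n powr (r / 2))) * (\<Delta> n * J))"
      unfolding t_def by (rule mult_left_mono) simp
    moreover have "real n * ((\<bar>t\<bar> / (m * \<Delta> n powr (r / 2))) * (\<Delta> n * J))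
        = (real n * \<bar>t\<bar>) / m * J * (\<Delta> n / \<Delta> n powr (r / 2))" by simp
    moreover have "real n * \<bar>t\<bar> = \<bar>u\<bar> * sqrt (real n)"
      using n by (simp add: t_def abs_divide field_simps)
    moreover have "\<Delta> n / \<Delta> n powr (r / 2) = \<Delta> n powr (1 - r / 2)" using d by (simp add: powr_diff)
    moreover have "\<bar>u\<bar> * sqrt (real n) / m * J * \<Delta> n powr (1 - r / 2)
        = \<bar>u\<bar> / m * J * (sqrt (real n) * \<Delta> n powr (1 - r / 2))" by simp
    ultimately have "real n * cmod (?A n Q - ?A n G) \<le> \<bar>u\<bar> / m * J * (sqrt (real n) * \<Delta> n powr (1 - r / 2))"
      by metis
    moreover have "cmod (?A n Q ^ n - ?A n G ^ n) \<le> real n * cmod (?A n Q - ?A n G)"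
      by (intro norm_power_diff cmod_integral_iexp_le_1 Q G n)
    ultimately show ?thesis by linarith
  qed
  have lim0: "(\<lambda>n. \<bar>u\<bar> / m * J * (sqrt (real n) * \<Delta> n powr (1 - r / 2))) \<longlonglongrightarrow> 0"
    using tendsto_mult_left[OF n\<Delta>r, of "\<bar>u\<bar> / m * J"] by (simp only: mult_zero_right)
  have ev: "\<forall>\<^sub>F n in sequentially.
      cmod (?A n Q ^ n - ?A n G ^ n) \<le> \<bar>u\<bar> / m * J * (sqrt (real n) * \<Delta> n powr (1 - r / 2))"
    by (rule eventually_sequentiallyI[of 1], rule bound) simp
  have "(\<lambda>n. ?A n Q ^ n - ?A n G ^ n) \<longlonglongrightarrow> 0"
    by (rule Lim_null_comparison[OF ev lim0])
  moreover have "(\<lambda>n. ?A n G ^ n) \<longlonglongrightarrow> ?l"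
    unfolding G_def using \<Delta> \<Delta>0 r n\<Delta> \<sigma> by (rule gaussian_increments_char_tendsto)
  ultimately have "(\<lambda>n. (?A n Q ^ n - ?A n G ^ n) + ?A n G ^ n) \<longlonglongrightarrow> 0 + ?l" by (rule tendsto_add)
  then have "(\<lambda>n. ?A n Q ^ n) \<longlonglongrightarrow> ?l" by (simp only: diff_add_cancel add_0)
  then show ?thesis
    by (rule Lim_transform_eventually)
      (rule eventually_sequentiallyI[of 1], use XQ in auto)
qed

section \<open>The drift of a subordinator\<close>

text \<open>
  Differentiation under the integral sign at 0, along the sequence \<open>u = 1 / (n + 1)\<close>. The weight
  \<open>g\<close> allows the same statement to be used for a probability law and for a jump measure.
\<close>
lemma iexp_difference_quotient_tendsto:
  fixes f g :: "'a \<Rightarrow> real"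
  assumes [measurable]: "f \<in> borel_measurable M" "g \<in> borel_measurable M"
    and i: "integrable M (\<lambda>x. f x * g x)"
  shows "(\<lambda>n. of_nat (Suc n) * (CLINT x|M. (iexp (f x / real (Suc n)) - 1) * g x))
    \<longlonglongrightarrow> \<i> * complex_of_real (LINT x|M. f x * g x)"
proof -
  have lim: "(\<lambda>n. of_nat (Suc n) * (iexp (y / real (Suc n)) - 1)) \<longlonglongrightarrow> \<i> * complex_of_real y" for y :: real
  proof -
    have le: "cmod (of_nat (Suc n) * (iexp (y / real (Suc n)) - 1) - \<i> * complex_of_real y)
        \<le> y\<^sup>2 / 2 * (1 / real (Suc n))" for n
    proof -
      let ?z = "y / real (Suc n)"
      have "of_nat (Suc n) * (iexp ?z - 1) - \<i> * complex_of_real y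
          = of_nat (Suc n) * (iexp ?z - (1 + \<i> * complex_of_real ?z))"
        by (simp add: field_simps del: of_nat_Suc)
      then have "cmod (of_nat (Suc n) * (iexp ?z - 1) - \<i> * complex_of_real y)
          = real (Suc n) * cmod (iexp ?z - (1 + \<i> * complex_of_real ?z))"
        by (simp only: norm_mult norm_of_nat)
      also have "\<dots> \<le> real (Suc n) * (\<bar>?z\<bar>\<^sup>2 / 2)"
        using iexp_approx1[of ?z 1] by (intro mult_left_mono) (auto simp: numeral_2_eq_2)
      also have "\<dots> = y\<^sup>2 / 2 * (1 / real (Suc n))"
        by (simp add: power_divide power2_eq_square field_simps del: of_nat_Suc)
      finally show ?thesis .
    qed
    have "(\<lambda>n. y\<^sup>2 / 2 * (1 / real (Suc n))) \<longlonglongrightarrow> y\<^sup>2 / 2 * 0"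
      by (intro tendsto_mult_left) (rule LIMSEQ_Suc[OF lim_1_over_n])
    then have lim0: "(\<lambda>n. y\<^sup>2 / 2 * (1 / real (Suc n))) \<longlonglongrightarrow> 0" by (simp only: mult_zero_right)
    have "(\<lambda>n. of_nat (Suc n) * (iexp (y / real (Suc n)) - 1) - \<i> * complex_of_real y) \<longlonglongrightarrow> 0"
      by (rule Lim_null_comparison[OF always_eventually[OF allI] lim0]) (rule le)
    then show ?thesis by (rule LIM_zero_cancel)
  qed
  have "(\<lambda>n. CLINT x|M. of_nat (Suc n) * (iexp (f x / real (Suc n)) - 1) * complex_of_real (g x))
    \<longlonglongrightarrow> (CLINT x|M. \<i> * complex_of_real (f x) * complex_of_real (g x))"
  proof (rule integral_dominated_convergence[where w="\<lambda>x. \<bar>f x * g x\<bar>"])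
    show "integrable M (\<lambda>x. \<bar>f x * g x\<bar>)" using i by (rule integrable_abs)
    show "AE x in M. (\<lambda>n. of_nat (Suc n) * (iexp (f x / real (Suc n)) - 1) * complex_of_real (g x))
        \<longlonglongrightarrow> \<i> * complex_of_real (f x) * complex_of_real (g x)"
      by (intro AE_I2 tendsto_mult_right lim)
    fix n
    show "AE x in M. norm (of_nat (Suc n) * (iexp (f x / real (Suc n)) - 1) * complex_of_real (g x)) \<le> \<bar>f x * g x\<bar>"
    proof (rule AE_I2)
      fix x
      have "real (Suc n) * cmod (iexp (f x / real (Suc n)) - 1) \<le> real (Suc n) * \<bar>f x / real (Suc n)\<bar>"
        using cmod_iexp_diff_le[of "f x / real (Suc n)" 0] by (intro mult_left_mono) auto
      also have "\<dots> = \<bar>f x\<bar>" by (simp add: abs_divide del: of_nat_Suc)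
      finally show "norm (of_nat (Suc n) * (iexp (f x / real (Suc n)) - 1) * complex_of_real (g x)) \<le> \<bar>f x * g x\<bar>"
        unfolding norm_mult norm_of_nat abs_mult norm_of_real by (rule mult_right_mono) simp
    qed
  qed measurable
  moreover have "(CLINT x|M. \<i> * complex_of_real (f x) * complex_of_real (g x)) = \<i> * complex_of_real (LINT x|M. f x * g x)"
    by (simp only: mult.assoc of_real_mult[symmetric] integral_mult_right_zero integral_complex_of_real)
  ultimately show ?thesis by (simp only: mult.assoc integral_mult_right_zero)
qed

text \<open>
  The logarithmic derivative of the characteristic function at 0 is \<open>i\<close> times the mean, hence the
  mean equals \<open>c\<close> plus the mean of the jumps. For a subordinator a positive \<open>c\<close> would add a term of
  order \<open>\<Delta>\<^sup>r\<^sup>/\<^sup>2\<close> to the \<open>r\<close>-th moment of the subordinated increments, the same order as the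
  Brownian component that is being estimated.
\<close>
lemma drift_eq_zero_if_mean_eq_jump_mean:
  fixes \<nu> :: "real \<Rightarrow> real"
  assumes "real_distribution N" and iN: "integrable N (\<lambda>x. x)"
    and [measurable]: "\<nu> \<in> borel_measurable borel" and i: "integrable lborel (\<lambda>x. x * \<nu> x)"
    and char_N: "\<And>u. char N u = exp (\<i> * complex_of_real (u * c) + (CLINT x|lborel. (iexp (u * x) - 1) * \<nu> x))"
    and mean: "(LINT x|N. x) = (LINT x|lborel. x * \<nu> x)"
  shows "c = 0"
proof -
  interpret N: real_distribution N by fact
  define E where "E = (LINT x|N. x)"
  define w where "w n = \<i> * complex_of_real (1 / real (Suc n) * c)
    + (CLINT x|lborel. (iexp (1 / real (Suc n) * x) - 1) * \<nu> x)" for n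
  have a: "(\<lambda>n. of_nat (Suc n) * (exp (w n) - 1)) \<longlonglongrightarrow> \<i> * complex_of_real E"
  proof -
    have m1: "(\<lambda>x. x) \<in> borel_measurable N" and m2: "(\<lambda>_. 1 :: real) \<in> borel_measurable N"
      by measurable
    have m3: "integrable N (\<lambda>x. x * 1)" using iN by simp
    note iexp_difference_quotient_tendsto[OF m1 m2 m3]
    moreover have "(CLINT x|N. (iexp (x / real (Suc n)) - 1) * complex_of_real 1) = exp (w n) - 1" for n
    proof -
      have i': "integrable N (\<lambda>x. iexp (1 / real (Suc n) * x))"
        by (rule N.integrable_const_bound[of _ 1]) auto
      have "(CLINT x|N. (iexp (x / real (Suc n)) - 1) * complex_of_real 1) = (CLINT x|N. iexp (1 / real (Suc n) * x) - 1)"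
        by simp
      also have "\<dots> = char N (1 / real (Suc n)) - 1"
        unfolding char_def using N.prob_space by (subst Bochner_Integration.integral_diff[OF i']) simp_all
      finally show ?thesis unfolding char_N w_def .
    qed
    ultimately show ?thesis by (simp add: E_def)
  qed
  have b: "(\<lambda>n. of_nat (Suc n) * w n) \<longlonglongrightarrow> \<i> * complex_of_real c + \<i> * complex_of_real E"
  proof -
    have e: "of_nat (Suc n) * w n = \<i> * complex_of_real c
        + of_nat (Suc n) * (CLINT x|lborel. (iexp (x / real (Suc n)) - 1) * \<nu> x)" for n
      by (simp add: w_def distrib_left del: of_nat_Suc)
    have l: "(\<lambda>n. of_nat (Suc n) * (CLINT x|lborel. (iexp (x / real (Suc n)) - 1) * \<nu> x))
        \<longlonglongrightarrow> \<i> * complex_of_real E"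
      unfolding E_def mean by (rule iexp_difference_quotient_tendsto[OF _ _ i]) measurable
    show ?thesis unfolding e by (rule tendsto_add[OF tendsto_const l])
  qed
  have w0: "w \<longlonglongrightarrow> 0"
  proof -
    have "(\<lambda>n. complex_of_real (1 / real (Suc n))) \<longlonglongrightarrow> complex_of_real 0"
      by (intro tendsto_of_real LIMSEQ_Suc[OF lim_1_over_n])
    from tendsto_mult[OF this b]
    show ?thesis by (simp add: field_simps del: of_nat_Suc)
  qed
  obtain g where g: "\<And>z. exp z - exp 0 = g z * (z - 0)" "isCont g (0::complex)" "g 0 = exp 0"
    using DERIV_exp[of "0::complex"] unfolding CARAT_DERIV by auto
  have "(\<lambda>n. g (w n) * (of_nat (Suc n) * w n)) \<longlonglongrightarrow> g 0 * (\<i> * complex_of_real c + \<i> * complex_of_real E)"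
    by (intro tendsto_mult isCont_tendsto_compose[OF g(2)] w0 b)
  moreover have "g (w n) * (of_nat (Suc n) * w n) = of_nat (Suc n) * (exp (w n) - 1)" for n
    using g(1)[of "w n"] by (simp add: mult_ac)
  ultimately have "(\<lambda>n. of_nat (Suc n) * (exp (w n) - 1)) \<longlonglongrightarrow> \<i> * complex_of_real c + \<i> * complex_of_real E"
    by (simp only: g(3) exp_zero mult_1_left)
  from LIMSEQ_unique[OF this a] show ?thesis by simp
qed

section \<open>Brownian motion run by an independent clock\<close>

lemma nn_integral_abs_powr_normal_law:
  assumes v: "0 < v" and p: "0 < p" "p \<le> 2"
  shows "(\<integral>\<^sup>+x. ennreal (\<bar>x\<bar> powr p) \<partial>normal_law 0 v) = ennreal (gauss_abs_moment p * v powr (p / 2))"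
proof -
  interpret N: real_distribution std_normal_distribution by (rule real_dist_normal_dist)
  have i: "integrable std_normal_distribution (\<lambda>x. \<bar>x\<bar> powr p)"
    using p by (intro integrable_abs_powr_std_normal) auto
  have e: "\<bar>0 + sqrt v * x\<bar> powr p = v powr (p / 2) * \<bar>x\<bar> powr p" for x
    using v by (simp add: abs_mult powr_mult powr_half_sqrt[symmetric] powr_powr)
  have "(\<integral>\<^sup>+x. ennreal (\<bar>x\<bar> powr p) \<partial>normal_law 0 v)
      = (\<integral>\<^sup>+x. ennreal (\<bar>0 + sqrt v * x\<bar> powr p) \<partial>std_normal_distribution)"
    unfolding normal_law_eq_distr[OF v] by (rule nn_integral_distr) measurable
  also have "\<dots> = (\<integral>\<^sup>+x. ennreal (v powr (p / 2) * \<bar>x\<bar> powr p) \<partial>std_normal_distribution)"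
    by (simp only: e)
  also have "\<dots> = ennreal (LINT x|std_normal_distribution. v powr (p / 2) * \<bar>x\<bar> powr p)"
    using i by (intro nn_integral_eq_integral) auto
  finally show ?thesis by (simp add: gauss_abs_moment_def mult.commute)
qed

lemma brownian_increment_moment:
  assumes B: "standard_brownian_motion M B" and p: "0 < p" "p \<le> 2" and st: "0 \<le> s" "0 \<le> t"
  shows "(\<integral>\<^sup>+\<omega>. ennreal (\<bar>B t \<omega> - B s \<omega>\<bar> powr p) \<partial>M)
    = ennreal (gauss_abs_moment p * \<bar>t - s\<bar> powr (p / 2))"
proof -
  have rv [measurable]: "B t \<in> borel_measurable M" if "0 \<le> t" for t
    using B that by (auto simp: standard_brownian_motion_def real_process_def)
  have *: "(\<integral>\<^sup>+\<omega>. ennreal (\<bar>B t \<omega> - B s \<omega>\<bar> powr p) \<partial>M)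
    = ennreal (gauss_abs_moment p * (t - s) powr (p / 2))" if "0 \<le> s" "s < t" for s t
  proof -
    have "(\<integral>\<^sup>+\<omega>. ennreal (\<bar>B t \<omega> - B s \<omega>\<bar> powr p) \<partial>M)
        = (\<integral>\<^sup>+x. ennreal (\<bar>x\<bar> powr p) \<partial>distr M borel (\<lambda>\<omega>. B t \<omega> - B s \<omega>))"
      using that by (subst nn_integral_distr) (auto intro!: borel_measurable_diff rv)
    also have "distr M borel (\<lambda>\<omega>. B t \<omega> - B s \<omega>) = normal_law 0 (t - s)"
      using B that by (simp add: standard_brownian_motion_def)
    finally show ?thesis using nn_integral_abs_powr_normal_law[of "t - s" p] that p by simp
  qed
  consider "s < t" | "t < s" | "s = t" by linarith
  then show ?thesis
  proof cases
    case 1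
    then show ?thesis using *[of s t] st by simp
  next
    case 2
    then show ?thesis using *[of t s] st by (simp add: abs_minus_commute)
  qed simp
qed

definition grid_floor :: "nat \<Rightarrow> real \<Rightarrow> real" where
  "grid_floor m x = real (nat \<lfloor>real (Suc m) * x\<rfloor>) / real (Suc m)"

lemma grid_floor_nonneg: "0 \<le> grid_floor m x"
  by (simp add: grid_floor_def)

lemma borel_measurable_grid_floor: "grid_floor m \<in> borel_measurable borel"
  unfolding grid_floor_def by measurable

lemma grid_floor_bounds:
  assumes "0 \<le> x"
  shows "x - 1 / real (Suc m) \<le> grid_floor m x" "grid_floor m x \<le> x"
proof -
  have "0 \<le> \<lfloor>real (Suc m) * x\<rfloor>" using assms by simp
  then have e: "real (nat \<lfloor>real (Suc m) * x\<rfloor>) = of_int \<lfloor>real (Suc m) * x\<rfloor>" by simp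
  have "real (Suc m) * x - 1 \<le> of_int \<lfloor>real (Suc m) * x\<rfloor>" by linarith
  then have "(real (Suc m) * x - 1) / real (Suc m) \<le> of_int \<lfloor>real (Suc m) * x\<rfloor> / real (Suc m)"
    by (rule divide_right_mono) simp
  moreover have "(real (Suc m) * x - 1) / real (Suc m) = x - 1 / real (Suc m)"
    by (simp add: diff_divide_distrib del: of_nat_Suc)
  ultimately show "x - 1 / real (Suc m) \<le> grid_floor m x" unfolding grid_floor_def e by simp
  have "of_int \<lfloor>real (Suc m) * x\<rfloor> / real (Suc m) \<le> (real (Suc m) * x) / real (Suc m)"
    by (intro divide_right_mono) auto
  then show "grid_floor m x \<le> x" unfolding grid_floor_def e by simp
qed

lemma grid_floor_tendsto:
  assumes "0 \<le> x"
  shows "(\<lambda>m. grid_floor m x) \<longlonglongrightarrow> x"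
proof (rule tendsto_sandwich)
  show "\<forall>\<^sub>F m in sequentially. x - 1 / real (Suc m) \<le> grid_floor m x"
    "\<forall>\<^sub>F m in sequentially. grid_floor m x \<le> x"
    using grid_floor_bounds[OF assms] by auto
  have "(\<lambda>m. x - 1 / real (Suc m)) \<longlonglongrightarrow> x - 0"
    by (intro tendsto_diff tendsto_const LIMSEQ_Suc[OF lim_1_over_n])
  then show "(\<lambda>m. x - 1 / real (Suc m)) \<longlonglongrightarrow> x" by simp
qed simp

text \<open>
  Conditionally on the clock, the increment of \<open>B\<close> is Gaussian with variance \<open>\<Gamma>\<^sub>t - \<Gamma>\<^sub>s\<close>. The
  evaluation of a path at a random time is not measurable on the product space of all paths, so
  the random times are first rounded down to a grid. Then only countably many coordinates of the
  path are involved, and independence together with Fubini's theorem applies. Continuity of \<open>B\<close>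
  and Fatou's lemma remove the rounding. The increment enters through a random variable \<open>D\<close> that
  agrees with it almost surely.
\<close>
lemma subordinated_brownian_increment_moment:
  fixes B \<Gamma> :: "real \<Rightarrow> 'a \<Rightarrow> real" and D :: "'a \<Rightarrow> real"
  assumes "prob_space M" and B: "standard_brownian_motion M B" and p: "0 < p" "p \<le> 1"
    and indep: "prob_space.indep_var M (\<Pi>\<^sub>M t\<in>{0..}. borel) (\<lambda>\<omega>. \<lambda>t\<in>{0..}. B t \<omega>)
      (\<Pi>\<^sub>M t\<in>{0..}. borel) (\<lambda>\<omega>. \<lambda>t\<in>{0..}. \<Gamma> t \<omega>)"
    and st: "0 \<le> s" "0 \<le> t"
    and nonneg: "AE \<omega> in M. 0 \<le> \<Gamma> s \<omega> \<and> 0 \<le> \<Gamma> t \<omega>"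
    and D [measurable]: "D \<in> borel_measurable M" and DB: "AE \<omega> in M. D \<omega> = B (\<Gamma> t \<omega>) \<omega> - B (\<Gamma> s \<omega>) \<omega>"
    and A: "0 \<le> A" "(\<integral>\<^sup>+\<omega>. ennreal (\<bar>\<Gamma> t \<omega> - \<Gamma> s \<omega>\<bar> powr (p / 2)) \<partial>M) \<le> ennreal A"
  shows "(\<integral>\<^sup>+\<omega>. ennreal (\<bar>D \<omega>\<bar> powr p) \<partial>M) \<le> ennreal (gauss_abs_moment p * A)"
proof -
  interpret prob_space M by fact
  define P where "P = (\<Pi>\<^sub>M t\<in>{0::real..}. borel :: real measure)"
  define path where "path \<omega> = (\<lambda>t\<in>{0..}. B t \<omega>)" for \<omega>
  define clock where "clock \<omega> = (\<lambda>t\<in>{0..}. \<Gamma> t \<omega>)" for \<omega>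
  define S where "S = \<Gamma> s"
  define T where "T = \<Gamma> t"
  have clock_eq: "clock \<omega> s = S \<omega>" "clock \<omega> t = T \<omega>" for \<omega>
    using st by (simp_all add: clock_def S_def T_def)
  have indep: "indep_var P path P clock"
    using indep unfolding P_def path_def clock_def .
  have path [measurable]: "path \<in> M \<rightarrow>\<^sub>M P" and clock [measurable]: "clock \<in> M \<rightarrow>\<^sub>M P"
    using indep_var_rv1[OF indep] indep_var_rv2[OF indep] .
  have ev_P: "(\<lambda>h. h x) \<in> borel_measurable P" if "0 \<le> x" for x
    unfolding P_def by (rule measurable_component_singleton) (use that in simp)
  have "(\<lambda>\<omega>. clock \<omega> s) \<in> borel_measurable M" "(\<lambda>\<omega>. clock \<omega> t) \<in> borel_measurable M"
    using measurable_compose[OF clock ev_P] st by auto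
  then have [measurable]: "S \<in> borel_measurable M" "T \<in> borel_measurable M"
    unfolding clock_eq .
  have nonneg: "AE \<omega> in M. 0 \<le> S \<omega> \<and> 0 \<le> T \<omega>" and DB: "AE \<omega> in M. D \<omega> = B (T \<omega>) \<omega> - B (S \<omega>) \<omega>"
    and A: "0 \<le> A" "(\<integral>\<^sup>+\<omega>. ennreal (\<bar>T \<omega> - S \<omega>\<bar> powr (p / 2)) \<partial>M) \<le> ennreal A"
    using nonneg DB A by (simp_all add: S_def T_def)
  have joint: "distr M P path \<Otimes>\<^sub>M distr M P clock = distr M (P \<Otimes>\<^sub>M P) (\<lambda>\<omega>. (path \<omega>, clock \<omega>))"
    using indep unfolding indep_var_distribution_eq by blast
  interpret P1: prob_space "distr M P path" by (rule prob_space_distr) (rule path)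
  interpret P2: prob_space "distr M P clock" by (rule prob_space_distr) (rule clock)
  interpret PP: pair_sigma_finite "distr M P path" "distr M P clock" ..
  define g where "g = gauss_abs_moment p"
  have g: "0 < g" unfolding g_def using p by (intro gauss_abs_moment_pos) auto
  define e where "e m = (1 / real (Suc m)) powr (p / 2)" for m
  \<comment> \<open>Rounding costs at most \<open>1 / (m + 1)\<close> in the elapsed clock time.\<close>
  have discrete: "(\<integral>\<^sup>+\<omega>. ennreal (\<bar>B (grid_floor m (T \<omega>)) \<omega> - B (grid_floor m (S \<omega>)) \<omega>\<bar> powr p) \<partial>M)
      \<le> ennreal (g * (A + e m))" for m
  proof -
    define F where "F z = ennreal (\<bar>fst z (grid_floor m (snd z t)) - fst z (grid_floor m (snd z s))\<bar> powr p)"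
      for z :: "(real \<Rightarrow> real) \<times> (real \<Rightarrow> real)"
    have coord: "(\<lambda>z. fst z (real i / real (Suc m))) \<in> borel_measurable (P \<Otimes>\<^sub>M P)" for i
      by (rule measurable_compose[OF measurable_fst ev_P]) simp
    have ev: "(\<lambda>z. fst z (grid_floor m (snd z x))) \<in> borel_measurable (P \<Otimes>\<^sub>M P)" if "0 \<le> x" for x
    proof -
      have [measurable]: "(\<lambda>z. snd z x) \<in> borel_measurable (P \<Otimes>\<^sub>M P)"
        by (rule measurable_compose[OF measurable_snd ev_P]) (rule that)
      show ?thesis
        unfolding grid_floor_def
        by (rule measurable_compose_countable[where f="\<lambda>i z. fst z (real i / real (Suc m))", OF coord]) measurable
    qed
    have F [measurable]: "F \<in> borel_measurable (P \<Otimes>\<^sub>M P)"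
    proof -
      note [measurable] = ev[OF st(1)] ev[OF st(2)]
      show ?thesis unfolding F_def by measurable
    qed
    have F_path: "F (path \<omega>, h)
        = ennreal (\<bar>B (grid_floor m (h t)) \<omega> - B (grid_floor m (h s)) \<omega>\<bar> powr p)" for \<omega> h
      by (simp add: F_def path_def grid_floor_nonneg)
    have "(\<integral>\<^sup>+\<omega>. ennreal (\<bar>B (grid_floor m (T \<omega>)) \<omega> - B (grid_floor m (S \<omega>)) \<omega>\<bar> powr p) \<partial>M)
        = (\<integral>\<^sup>+\<omega>. F (path \<omega>, clock \<omega>) \<partial>M)"
      unfolding F_path clock_eq ..
    also have "\<dots> = integral\<^sup>N (distr M (P \<Otimes>\<^sub>M P) (\<lambda>\<omega>. (path \<omega>, clock \<omega>))) F"
      by (rule nn_integral_distr[symmetric]) measurable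
    also have "\<dots> = (\<integral>\<^sup>+h. \<integral>\<^sup>+w. F (w, h) \<partial>distr M P path \<partial>distr M P clock)"
      unfolding joint[symmetric] by (rule PP.nn_integral_snd[symmetric]) simp
    also have "\<dots> = (\<integral>\<^sup>+h. ennreal (g * \<bar>grid_floor m (h t) - grid_floor m (h s)\<bar> powr (p / 2)) \<partial>distr M P clock)"
    proof (rule nn_integral_cong)
      fix h assume "h \<in> space (distr M P clock)"
      then have [measurable]: "(\<lambda>w. F (w, h)) \<in> borel_measurable P"
        using measurable_compose[OF measurable_Pair2'[of h P P] F] by simp
      have "(\<integral>\<^sup>+w. F (w, h) \<partial>distr M P path) = (\<integral>\<^sup>+\<omega>. F (path \<omega>, h) \<partial>M)"
        by (rule nn_integral_distr) measurable
      also have "\<dots> = ennreal (g * \<bar>grid_floor m (h t) - grid_floor m (h s)\<bar> powr (p / 2))"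
        unfolding F_path g_def using B p grid_floor_nonneg by (intro brownian_increment_moment) auto
      finally show "(\<integral>\<^sup>+w. F (w, h) \<partial>distr M P path)
        = ennreal (g * \<bar>grid_floor m (h t) - grid_floor m (h s)\<bar> powr (p / 2))" .
    qed
    also have "\<dots> = (\<integral>\<^sup>+\<omega>. ennreal (g * \<bar>grid_floor m (clock \<omega> t) - grid_floor m (clock \<omega> s)\<bar> powr (p / 2)) \<partial>M)"
    proof -
      note [measurable] = measurable_compose[OF ev_P[OF st(1)] borel_measurable_grid_floor, of m]
        measurable_compose[OF ev_P[OF st(2)] borel_measurable_grid_floor, of m]
      have [measurable]: "(\<lambda>h. ennreal (g * \<bar>grid_floor m (h t) - grid_floor m (h s)\<bar> powr (p / 2))) \<in> borel_measurable P"
        by measurable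
      show ?thesis by (rule nn_integral_distr) measurable
    qed
    also have "\<dots> = (\<integral>\<^sup>+\<omega>. ennreal (g * \<bar>grid_floor m (T \<omega>) - grid_floor m (S \<omega>)\<bar> powr (p / 2)) \<partial>M)"
      unfolding clock_eq ..
    also have "\<dots> \<le> (\<integral>\<^sup>+\<omega>. ennreal g * (ennreal (\<bar>T \<omega> - S \<omega>\<bar> powr (p / 2)) + ennreal (e m)) \<partial>M)"
    proof (rule nn_integral_mono_AE)
      show "AE \<omega> in M. ennreal (g * \<bar>grid_floor m (T \<omega>) - grid_floor m (S \<omega>)\<bar> powr (p / 2))
          \<le> ennreal g * (ennreal (\<bar>T \<omega> - S \<omega>\<bar> powr (p / 2)) + ennreal (e m))"
        using nonneg
      proof eventually_elim
        case (elim \<omega>)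
        have "\<bar>grid_floor m (T \<omega>) - grid_floor m (S \<omega>)\<bar> \<le> \<bar>T \<omega> - S \<omega>\<bar> + 1 / real (Suc m)"
          using grid_floor_bounds[of "T \<omega>" m] grid_floor_bounds[of "S \<omega>" m] elim by linarith
        then have "\<bar>grid_floor m (T \<omega>) - grid_floor m (S \<omega>)\<bar> powr (p / 2) \<le> (\<bar>T \<omega> - S \<omega>\<bar> + 1 / real (Suc m)) powr (p / 2)"
          using p by (intro powr_mono2) auto
        also have "\<dots> \<le> \<bar>T \<omega> - S \<omega>\<bar> powr (p / 2) + e m"
          unfolding e_def using p by (intro powr_add_le_add_powr) auto
        finally have "g * \<bar>grid_floor m (T \<omega>) - grid_floor m (S \<omega>)\<bar> powr (p / 2) \<le> g * (\<bar>T \<omega> - S \<omega>\<bar> powr (p / 2) + e m)"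
          using g by (intro mult_left_mono) auto
        then have "ennreal (g * \<bar>grid_floor m (T \<omega>) - grid_floor m (S \<omega>)\<bar> powr (p / 2))
            \<le> ennreal (g * (\<bar>T \<omega> - S \<omega>\<bar> powr (p / 2) + e m))" by (rule ennreal_leI)
        also have "\<dots> = ennreal g * (ennreal (\<bar>T \<omega> - S \<omega>\<bar> powr (p / 2)) + ennreal (e m))"
          using g by (simp add: ennreal_mult ennreal_plus e_def)
        finally show ?case .
      qed
    qed
    also have "\<dots> = ennreal g * ((\<integral>\<^sup>+\<omega>. ennreal (\<bar>T \<omega> - S \<omega>\<bar> powr (p / 2)) \<partial>M) + ennreal (e m))"
      by (simp add: nn_integral_cmult nn_integral_add emeasure_space_1)
    also have "\<dots> \<le> ennreal g * (ennreal A + ennreal (e m))"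
      by (intro mult_left_mono add_right_mono A) simp
    also have "\<dots> = ennreal (g * (A + e m))"
      using g A by (simp add: ennreal_mult ennreal_plus e_def)
    finally show ?thesis .
  qed
  have cont: "AE \<omega> in M. continuous_on {0..} (\<lambda>t. B t \<omega>)"
    using B by (simp add: standard_brownian_motion_def)
  have Bm: "(\<lambda>\<omega>. B (grid_floor m (f \<omega>)) \<omega>) \<in> borel_measurable M" if [measurable]: "f \<in> borel_measurable M" for m f
    unfolding grid_floor_def
  proof (rule measurable_compose_countable[where f="\<lambda>i \<omega>. B (real i / real (Suc m)) \<omega>"])
    show "B (real i / real (Suc m)) \<in> borel_measurable M" for i
      using B by (simp add: standard_brownian_motion_def real_process_def)
  qed measurable
  have lim: "AE \<omega> in M. (\<lambda>m. ennreal (\<bar>B (grid_floor m (T \<omega>)) \<omega> - B (grid_floor m (S \<omega>)) \<omega>\<bar> powr p))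
      \<longlonglongrightarrow> ennreal (\<bar>D \<omega>\<bar> powr p)"
    using cont nonneg DB
  proof eventually_elim
    case (elim \<omega>)
    have *: "(\<lambda>m. B (grid_floor m x) \<omega>) \<longlonglongrightarrow> B x \<omega>" if "0 \<le> x" for x
      by (rule continuous_on_tendsto_compose[OF elim(1) grid_floor_tendsto])
        (use that grid_floor_nonneg in auto)
    have "(\<lambda>m. B (grid_floor m (T \<omega>)) \<omega> - B (grid_floor m (S \<omega>)) \<omega>) \<longlonglongrightarrow> D \<omega>"
      unfolding elim(3) using elim(2) by (intro tendsto_diff *) auto
    from isCont_tendsto_compose[OF isCont_abs_powr[OF p(1)] this]
    show ?case by (rule tendsto_ennrealI)
  qed
  have e0: "e \<longlonglongrightarrow> 0"
    unfolding e_def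
    by (rule tendsto_zero_powrI[OF LIMSEQ_Suc[OF lim_1_over_n] tendsto_const]) (use p in auto)
  have "(\<integral>\<^sup>+\<omega>. ennreal (\<bar>D \<omega>\<bar> powr p) \<partial>M)
    = (\<integral>\<^sup>+\<omega>. liminf (\<lambda>m. ennreal (\<bar>B (grid_floor m (T \<omega>)) \<omega> - B (grid_floor m (S \<omega>)) \<omega>\<bar> powr p)) \<partial>M)"
  proof (rule nn_integral_cong_AE)
    show "AE \<omega> in M. ennreal (\<bar>D \<omega>\<bar> powr p)
        = liminf (\<lambda>m. ennreal (\<bar>B (grid_floor m (T \<omega>)) \<omega> - B (grid_floor m (S \<omega>)) \<omega>\<bar> powr p))"
      using lim by eventually_elim (rule lim_imp_Liminf[symmetric], simp)
  qed
  also have "\<dots> \<le> liminf (\<lambda>m. \<integral>\<^sup>+\<omega>. ennreal (\<bar>B (grid_floor m (T \<omega>)) \<omega> - B (grid_floor m (S \<omega>)) \<omega>\<bar> powr p) \<partial>M)"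
  proof (rule nn_integral_liminf)
    fix m
    have [measurable]: "(\<lambda>\<omega>. B (grid_floor m (T \<omega>)) \<omega>) \<in> borel_measurable M"
      "(\<lambda>\<omega>. B (grid_floor m (S \<omega>)) \<omega>) \<in> borel_measurable M"
      by (rule Bm, measurable)+
    show "(\<lambda>\<omega>. ennreal (\<bar>B (grid_floor m (T \<omega>)) \<omega> - B (grid_floor m (S \<omega>)) \<omega>\<bar> powr p)) \<in> borel_measurable M"
      by measurable
  qed
  also have "\<dots> \<le> liminf (\<lambda>m. ennreal (g * (A + e m)))"
    by (rule Liminf_mono) (use discrete in simp)
  also have "\<dots> = ennreal (g * A)"
  proof (rule lim_imp_Liminf)
    have "(\<lambda>m. g * (A + e m)) \<longlonglongrightarrow> g * (A + 0)" by (intro tendsto_intros e0)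
    then show "(\<lambda>m. ennreal (g * (A + e m))) \<longlonglongrightarrow> ennreal (g * A)" by (intro tendsto_ennrealI) simp
  qed simp
  finally show ?thesis unfolding g_def .
qed

lemma (in prob_space) indep_var_of_indep_vars:
  assumes "indep_vars (\<lambda>_. N) X I" "i \<in> I" "j \<in> I" "i \<noteq> j"
  shows "indep_var N (X i) N (X j)"
proof -
  have "indep_var (PiM {i} (\<lambda>_. N)) (\<lambda>\<omega>. restrict (\<lambda>i. X i \<omega>) {i}) (PiM {j} (\<lambda>_. N)) (\<lambda>\<omega>. restrict (\<lambda>i. X i \<omega>) {j})"
    by (rule indep_var_restrict[OF assms(1)]) (use assms in auto)
  from indep_var_compose[OF this, of "\<lambda>f. f i" N "\<lambda>f. f j" N]
  show ?thesis by (simp add: comp_def measurable_component_singleton)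
qed

section \<open>Brownian motion plus subordinated Brownian motion\<close>

text \<open>
  The assumption on the mean makes the drift of the subordinator vanish, so that its increments are
  pure jump and \<open>pure_jump_fractional_moment\<close> applies.
\<close>
lemma subordinator_increment_moment:
  assumes "prob_space M" and \<Gamma>: "subordinator_with_density M \<Gamma> \<nu>" and i\<Gamma>: "integrable M (\<Gamma> 1)"
    and i1: "set_integrable lborel {0<..} (\<lambda>\<gamma>. \<gamma> * \<nu> \<gamma>)"
    and mean: "integral\<^sup>L M (\<Gamma> 1) = (LINT \<gamma>:{0<..}|lborel. \<gamma> * \<nu> \<gamma>)"
    and q: "0 < q" "q \<le> 1" and iq: "set_integrable lborel {0<..} (\<lambda>\<gamma>. \<gamma> powr q * \<nu> \<gamma>)"
    and st: "0 \<le> s" "s \<le> t"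
  shows "(\<integral>\<^sup>+\<omega>. ennreal (\<bar>\<Gamma> t \<omega> - \<Gamma> s \<omega>\<bar> powr q) \<partial>M)
    \<le> ennreal ((t - s) * (LINT \<gamma>:{0<..}|lborel. \<gamma> powr q * \<nu> \<gamma>))"
proof -
  interpret prob_space M by fact
  define \<mu> where "\<mu> x = indicator {0<..} x * \<nu> x" for x :: real
  have lp: "levy_process M \<Gamma>" using \<Gamma> by (simp add: subordinator_with_density_def)
  have [measurable]: "\<mu> \<in> borel_measurable borel"
    using \<Gamma> by (simp add: subordinator_with_density_def set_borel_measurable_def \<mu>_def[abs_def])
  have nn: "0 \<le> \<mu> x" for x
    using \<Gamma> by (auto simp: subordinator_with_density_def \<mu>_def indicator_def)
  have rv: "\<Gamma> t \<in> borel_measurable M" if "0 \<le> t" for t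
    using lp that by (auto simp: levy_process_def real_process_def)
  have p1: "indicator {0<..} x *\<^sub>R (x * \<nu> x) = x * \<mu> x" for x :: real by (simp add: \<mu>_def)
  have pq: "indicator {0<..} x *\<^sub>R (x powr q * \<nu> x) = \<bar>x\<bar> powr q * \<mu> x" for x :: real
    by (simp add: \<mu>_def indicator_def)
  have pc: "indicator {0<..} x *\<^sub>R ((iexp (u * x) - 1) * complex_of_real (\<nu> x)) = (iexp (u * x) - 1) * \<mu> x"
    for x u :: real by (simp add: \<mu>_def indicator_def)
  have i1: "integrable lborel (\<lambda>x. x * \<mu> x)" using i1 unfolding set_integrable_def p1 .
  have iq: "integrable lborel (\<lambda>x. \<bar>x\<bar> powr q * \<mu> x)" using iq unfolding set_integrable_def pq .
  have mean: "integral\<^sup>L M (\<Gamma> 1) = (LINT x|lborel. x * \<mu> x)"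
    using mean unfolding set_lebesgue_integral_def p1 .
  obtain c where c: "\<And>t u. 0 \<le> t \<Longrightarrow> char (distr M borel (\<Gamma> t)) u =
      exp (complex_of_real t * (\<i> * complex_of_real (u * c) + (CLINT x|lborel. (iexp (u * x) - 1) * \<mu> x)))"
    using \<Gamma> unfolding subordinator_with_density_def set_lebesgue_integral_def pc by blast
  have "c = 0"
  proof (rule drift_eq_zero_if_mean_eq_jump_mean)
    show "real_distribution (distr M borel (\<Gamma> 1))" using rv by simp
    show "integrable (distr M borel (\<Gamma> 1)) (\<lambda>x. x)"
      using i\<Gamma> rv[of 1] by (simp add: integrable_distr_eq)
    show "integrable lborel (\<lambda>x. x * \<mu> x)" by (rule i1)
    show "char (distr M borel (\<Gamma> 1)) u = exp (\<i> * complex_of_real (u * c) + (CLINT x|lborel. (iexp (u * x) - 1) * \<mu> x))" for u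
      using c[of 1 u] by simp
    show "(LINT x|distr M borel (\<Gamma> 1). x) = (LINT x|lborel. x * \<mu> x)"
      using mean rv[of 1] by (simp add: integral_distr)
  qed simp
  have ts: "0 \<le> t - s" using st by simp
  have "(\<integral>\<^sup>+\<omega>. ennreal (\<bar>\<Gamma> t \<omega> - \<Gamma> s \<omega>\<bar> powr q) \<partial>M)
      = (\<integral>\<^sup>+x. ennreal (\<bar>x\<bar> powr q) \<partial>distr M borel (\<lambda>\<omega>. \<Gamma> t \<omega> - \<Gamma> s \<omega>))"
    using st by (intro nn_integral_distr[symmetric] borel_measurable_diff rv) auto
  also have "\<dots> = (\<integral>\<^sup>+x. ennreal (\<bar>x\<bar> powr q) \<partial>distr M borel (\<Gamma> (t - s)))"
    using distr_levy_increment[OF lp st] by simp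
  also have "\<dots> \<le> ennreal ((t - s) * (LINT x|lborel. \<bar>x\<bar> powr q * \<mu> x))"
  proof (rule pure_jump_fractional_moment)
    show "real_distribution (distr M borel (\<Gamma> (t - s)))" using rv[OF ts] by simp
    show "char (distr M borel (\<Gamma> (t - s))) u
        = exp (complex_of_real (t - s) * (CLINT x|lborel. (iexp (u * x) - 1) * \<mu> x))" for u
      using c[OF ts, of u] \<open>c = 0\<close> by simp
  qed (use nn q iq ts in auto)
  finally show ?thesis unfolding set_lebesgue_integral_def pq .
qed

lemma cmod_char_diff_le:
  assumes "prob_space M" and [measurable]: "S \<in> borel_measurable M" "S' \<in> borel_measurable M"
  shows "ennreal (cmod (char (distr M borel S) u - char (distr M borel S') u))
    \<le> ennreal \<bar>u\<bar> * (\<integral>\<^sup>+\<omega>. ennreal \<bar>S \<omega> - S' \<omega>\<bar> \<partial>M)"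
proof -
  interpret prob_space M by fact
  have i: "integrable M (\<lambda>\<omega>. iexp (u * f \<omega>))" if [measurable]: "f \<in> borel_measurable M" for f
    by (rule integrable_const_bound[of _ 1]) auto
  have e: "char (distr M borel S) u - char (distr M borel S') u = (CLINT \<omega>|M. iexp (u * S \<omega>) - iexp (u * S' \<omega>))"
    unfolding char_def by (subst (1 2) integral_distr) (auto simp del: of_real_mult intro!: Bochner_Integration.integral_diff[symmetric] i)
  have "ennreal (cmod (CLINT \<omega>|M. iexp (u * S \<omega>) - iexp (u * S' \<omega>)))
      \<le> (\<integral>\<^sup>+\<omega>. ennreal (cmod (iexp (u * S \<omega>) - iexp (u * S' \<omega>))) \<partial>M)"
    by (rule integral_norm_bound_ennreal) (intro Bochner_Integration.integrable_diff i, measurable)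
  also have "\<dots> \<le> (\<integral>\<^sup>+\<omega>. ennreal \<bar>u\<bar> * ennreal \<bar>S \<omega> - S' \<omega>\<bar> \<partial>M)"
  proof (rule nn_integral_mono)
    fix \<omega>
    have "cmod (iexp (u * S \<omega>) - iexp (u * S' \<omega>)) \<le> \<bar>u * S \<omega> - u * S' \<omega>\<bar>" by (rule cmod_iexp_diff_le)
    also have "\<dots> = \<bar>u\<bar> * \<bar>S \<omega> - S' \<omega>\<bar>" by (simp only: abs_mult[symmetric] right_diff_distrib)
    finally show "ennreal (cmod (iexp (u * S \<omega>) - iexp (u * S' \<omega>))) \<le> ennreal \<bar>u\<bar> * ennreal \<bar>S \<omega> - S' \<omega>\<bar>"
      by (simp only: ennreal_mult[symmetric] abs_ge_zero) (rule ennreal_leI)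
  qed
  also have "\<dots> = ennreal \<bar>u\<bar> * (\<integral>\<^sup>+\<omega>. ennreal \<bar>S \<omega> - S' \<omega>\<bar> \<partial>M)"
    by (rule nn_integral_cmult) measurable
  finally show ?thesis unfolding e .
qed

text \<open>
  Here \<open>L\<close> and the drifted Brownian motion \<open>b t + \<sigma> W\<^sub>t\<close> live on the same space, so they can be
  compared path by path. The Gaussian increments \<open>Y\<^sub>k\<close> have exactly the law treated in
  \<open>gaussian_increments_char_tendsto\<close>, and by subadditivity the two errors \<open>S\<close> and \<open>S'\<close> differ
  by at most the sum of the \<open>r\<close>-th powers of the increments \<open>J\<^sub>k\<close> of \<open>X\<close>, suitably normalised.
  The mean of \<open>|J\<^sub>k|\<^sup>r\<close> is \<open>O(\<Delta>)\<close>, so the difference tends to 0 in \<open>L\<^sup>1\<close>.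
\<close>
lemma subordinated_case_char_tendsto:
  assumes "prob_space M"
    and W: "standard_brownian_motion M W" and B: "standard_brownian_motion M B"
    and \<Gamma>: "subordinator_with_density M \<Gamma> \<nu>" and indep: "independent_processes3 M W B \<Gamma>"
    and i\<Gamma>: "integrable M (\<Gamma> 1)"
    and i1: "set_integrable lborel {0<..} (\<lambda>\<gamma>. \<gamma> * \<nu> \<gamma>)"
    and mean: "integral\<^sup>L M (\<Gamma> 1) = (LINT \<gamma>:{0<..}|lborel. \<gamma> * \<nu> \<gamma>)"
    and ir: "set_integrable lborel {0<..} (\<lambda>\<gamma>. \<gamma> powr (r / 2) * \<nu> \<gamma>)"
    and X: "real_process M X" and XB: "\<And>t. 0 \<le> t \<Longrightarrow> AE \<omega> in M. X t \<omega> = B (\<Gamma> t \<omega>) \<omega>"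
    and L: "real_process M L" and LX: "\<And>t. 0 \<le> t \<Longrightarrow> AE \<omega> in M. L t \<omega> = b * t + \<sigma> * W t \<omega> + X t \<omega>"
    and \<Delta>: "\<And>n. 0 < n \<Longrightarrow> 0 < \<Delta> n" and \<Delta>0: "\<Delta> \<longlonglongrightarrow> 0" and r: "0 < r" "r \<le> 1" and \<sigma>: "0 < \<sigma>"
    and n\<Delta>: "(\<lambda>n. sqrt (real n) * \<Delta> n) \<longlonglongrightarrow> 0"
    and n\<Delta>r: "(\<lambda>n. sqrt (real n) * \<Delta> n powr (1 - r / 2)) \<longlonglongrightarrow> 0"
  shows "(\<lambda>n. char (distr M borel (\<lambda>\<omega>. sqrt (real n) *
        (power_variation_estimator L (\<Delta> n) r n \<omega> - \<sigma> powr r))) u)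
    \<longlonglongrightarrow> exp (- (\<sigma> powr (2 * r) * (gauss_abs_moment (2 * r) / (gauss_abs_moment r)\<^sup>2 - 1) * u\<^sup>2 / 2))"
    (is "?X \<longlonglongrightarrow> ?l")
proof -
  interpret prob_space M by fact
  have Lm: "L t \<in> borel_measurable M" and Xm: "X t \<in> borel_measurable M" and Wm: "W t \<in> borel_measurable M"
    if "0 \<le> t" for t
    using L X W that by (auto simp: real_process_def standard_brownian_motion_def)
  define m where "m = gauss_abs_moment r"
  have m: "0 < m" unfolding m_def using r by (intro gauss_abs_moment_pos) auto
  define I where "I = (LINT \<gamma>:{0<..}|lborel. \<gamma> powr (r / 2) * \<nu> \<gamma>)"
  have I: "0 \<le> I"
    unfolding I_def set_lebesgue_integral_def using \<Gamma>
    by (intro Bochner_Integration.integral_nonneg) (auto simp: subordinator_with_density_def indicator_def)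
  have lp: "levy_process M \<Gamma>" and mono: "AE \<omega> in M. mono_on {0..} (\<lambda>t. \<Gamma> t \<omega>)"
    using \<Gamma> by (auto simp: subordinator_with_density_def)
  have \<Gamma>0: "AE \<omega> in M. 0 \<le> \<Gamma> t \<omega>" if "0 \<le> t" for t
  proof -
    have "AE \<omega> in M. \<Gamma> 0 \<omega> = 0" using lp by (simp add: levy_process_def)
    with mono show ?thesis
      by eventually_elim (use that in \<open>force simp: mono_on_def\<close>)
  qed
  have indep_B\<Gamma>: "indep_var (\<Pi>\<^sub>M t\<in>{0..}. borel) (\<lambda>\<omega>. \<lambda>t\<in>{0..}. B t \<omega>) (\<Pi>\<^sub>M t\<in>{0..}. borel) (\<lambda>\<omega>. \<lambda>t\<in>{0..}. \<Gamma> t \<omega>)"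
    using indep_var_of_indep_vars[OF indep[unfolded independent_processes3_def], of 1 2] by simp
  have jump: "(\<integral>\<^sup>+\<omega>. ennreal (\<bar>X t \<omega> - X s \<omega>\<bar> powr r) \<partial>M) \<le> ennreal (m * ((t - s) * I))"
    if st: "0 \<le> s" "s \<le> t" for s t
    unfolding m_def
  proof (rule subordinated_brownian_increment_moment[OF \<open>prob_space M\<close> B r indep_B\<Gamma>])
    show "0 \<le> s" "0 \<le> t" using st by auto
    show "AE \<omega> in M. 0 \<le> \<Gamma> s \<omega> \<and> 0 \<le> \<Gamma> t \<omega>" using \<Gamma>0 st by auto
    show "(\<lambda>\<omega>. X t \<omega> - X s \<omega>) \<in> borel_measurable M" using Xm st by (intro borel_measurable_diff) auto
    show "AE \<omega> in M. X t \<omega> - X s \<omega> = B (\<Gamma> t \<omega>) \<omega> - B (\<Gamma> s \<omega>) \<omega>"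
      using XB[of s] XB[of t] st by auto
    show "0 \<le> (t - s) * I" using st I by simp
    show "(\<integral>\<^sup>+\<omega>. ennreal (\<bar>\<Gamma> t \<omega> - \<Gamma> s \<omega>\<bar> powr (r / 2)) \<partial>M) \<le> ennreal ((t - s) * I)"
      unfolding I_def using r st by (intro subordinator_increment_moment[OF \<open>prob_space M\<close> \<Gamma> i\<Gamma> i1 mean _ _ ir]) auto
  qed
  define G where "G n = distr std_normal_distribution borel (\<lambda>x. b * \<Delta> n + \<sigma> * sqrt (\<Delta> n) * x)" for n
  let ?A = "\<lambda>n. CLINT x|G n. iexp (u / sqrt (real n) * rescaled_power_error r \<sigma> (\<Delta> n) x)"
  have bound: "cmod (?X n - ?A n ^ n) \<le> \<bar>u\<bar> * I * (sqrt (real n) * \<Delta> n powr (1 - r / 2))"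
    if n: "0 < n" for n
  proof -
    define \<delta> where "\<delta> = \<Delta> n"
    have d: "0 < \<delta>" unfolding \<delta>_def using \<Delta> n .
    have grid: "0 \<le> real k * \<delta>" "real k * \<delta> \<le> real (Suc k) * \<delta>" "0 \<le> real (Suc k) * \<delta>"
      "real (Suc k) * \<delta> - real k * \<delta> = \<delta>" "real k * \<delta> < real (Suc k) * \<delta>" for k
      using d by (auto simp: algebra_simps)
    define Z where "Z k \<omega> = L (real (Suc k) * \<delta>) \<omega> - L (real k * \<delta>) \<omega>" for k \<omega>
    define V where "V k \<omega> = W (real (Suc k) * \<delta>) \<omega> - W (real k * \<delta>) \<omega>" for k \<omega>
    define Y where "Y k \<omega> = b * \<delta> + \<sigma> * V k \<omega>" for k \<omega>
    define J where "J k \<omega> = X (real (Suc k) * \<delta>) \<omega> - X (real k * \<delta>) \<omega>" for k \<omega>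
    have [measurable]: "Z k \<in> borel_measurable M" "V k \<in> borel_measurable M" "J k \<in> borel_measurable M" for k
      unfolding Z_def V_def J_def using grid by (intro borel_measurable_diff Lm Wm Xm; simp)+
    then have [measurable]: "Y k \<in> borel_measurable M" for k unfolding Y_def by measurable
    define S where "S \<omega> = (\<Sum>k<n. rescaled_power_error r \<sigma> \<delta> (Z k \<omega>) / sqrt (real n))" for \<omega>
    define S' where "S' \<omega> = (\<Sum>k<n. rescaled_power_error r \<sigma> \<delta> (Y k \<omega>) / sqrt (real n))" for \<omega>
    have S_measurable: "S \<in> borel_measurable M" "S' \<in> borel_measurable M" unfolding S_def S'_def by measurable
    have XS: "?X n = char (distr M borel S) u"
      unfolding S_def Z_def \<delta>_def power_variation_error_eq_sum[OF n d[unfolded \<delta>_def]] ..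
    have AS: "char (distr M borel S') u = ?A n ^ n"
      unfolding S'_def \<delta>_def[symmetric]
    proof (rule char_iid_average)
      have "indep_vars (\<lambda>_. borel) V {..<n}"
        unfolding V_def using W d by (intro indep_grid_increments) (auto simp: standard_brownian_motion_def)
      then show "indep_vars (\<lambda>_. borel) Y {..<n}"
        unfolding Y_def by (rule indep_vars_compose2) measurable
      fix k
      have law_V: "distr M borel (V k) = normal_law 0 \<delta>"
        unfolding V_def using W grid[of k] by (simp add: standard_brownian_motion_def)
      have "distr M borel (Y k) = distr (distr M borel (V k)) borel (\<lambda>x. b * \<delta> + \<sigma> * x)"
        unfolding Y_def by (subst distr_distr) (auto simp: comp_def)
      also have "\<dots> = G n"
        unfolding law_V normal_law_eq_distr[OF d] G_def \<delta>_def[symmetric]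
        by (subst distr_distr) (auto simp: comp_def algebra_simps)
      finally show "distr M borel (Y k) = G n" .
    qed measurable
    define c where "c = 1 / (m * \<delta> powr (r / 2) * sqrt (real n))"
    have c: "0 \<le> c" using m d by (simp add: c_def)
    have SS: "AE \<omega> in M. ennreal \<bar>S \<omega> - S' \<omega>\<bar> \<le> (\<Sum>k<n. ennreal c * ennreal (\<bar>J k \<omega>\<bar> powr r))"
    proof -
      have "AE \<omega> in M. \<forall>k\<in>{..<n}. Z k \<omega> - Y k \<omega> = J k \<omega>"
      proof (rule AE_finite_allI)
        fix k
        have e: "b * (real (Suc k) * \<delta>) - b * (real k * \<delta>) = b * \<delta>" by (simp add: algebra_simps)
        show "AE \<omega> in M. Z k \<omega> - Y k \<omega> = J k \<omega>"
          using LX[OF grid(1)[of k]] LX[OF grid(3)[of k]]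
        proof eventually_elim
          case (elim \<omega>)
          then show ?case using e unfolding Z_def Y_def V_def J_def by (simp add: algebra_simps)
        qed
      qed simp
      then show ?thesis
      proof eventually_elim
        case (elim \<omega>)
        have "\<bar>S \<omega> - S' \<omega>\<bar> = \<bar>\<Sum>k<n. (rescaled_power_error r \<sigma> \<delta> (Z k \<omega>) - rescaled_power_error r \<sigma> \<delta> (Y k \<omega>)) / sqrt (real n)\<bar>"
          unfolding S_def S'_def by (simp only: sum_subtractf diff_divide_distrib)
        also have "\<dots> \<le> (\<Sum>k<n. \<bar>(rescaled_power_error r \<sigma> \<delta> (Z k \<omega>) - rescaled_power_error r \<sigma> \<delta> (Y k \<omega>)) / sqrt (real n)\<bar>)"
          by (rule sum_abs)
        also have "\<dots> \<le> (\<Sum>k<n. c * \<bar>J k \<omega>\<bar> powr r)"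
        proof (rule sum_mono)
          fix k assume "k \<in> {..<n}"
          then have ZY: "Z k \<omega> - Y k \<omega> = J k \<omega>" using elim by blast
          have "\<bar>rescaled_power_error r \<sigma> \<delta> (Z k \<omega>) - rescaled_power_error r \<sigma> \<delta> (Y k \<omega>)\<bar> / sqrt (real n)
              \<le> \<bar>J k \<omega>\<bar> powr r / (m * \<delta> powr (r / 2)) / sqrt (real n)"
            using rescaled_power_error_diff_le[OF r d, of \<sigma> "Z k \<omega>" "Y k \<omega>"] unfolding ZY m_def
            by (intro divide_right_mono) auto
          then show "\<bar>(rescaled_power_error r \<sigma> \<delta> (Z k \<omega>) - rescaled_power_error r \<sigma> \<delta> (Y k \<omega>)) / sqrt (real n)\<bar> \<le> c * \<bar>J k \<omega>\<bar> powr r"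
            by (simp add: c_def abs_divide)
        qed
        finally have "ennreal \<bar>S \<omega> - S' \<omega>\<bar> \<le> ennreal (\<Sum>k<n. c * \<bar>J k \<omega>\<bar> powr r)" by (rule ennreal_leI)
        also have "\<dots> = (\<Sum>k<n. ennreal c * ennreal (\<bar>J k \<omega>\<bar> powr r))"
          using c by (simp add: sum_ennreal[symmetric] ennreal_mult)
        finally show ?case .
      qed
    qed
    have XA: "?X n - ?A n ^ n = char (distr M borel S) u - char (distr M borel S') u"
      unfolding XS AS ..
    have "ennreal (cmod (char (distr M borel S) u - char (distr M borel S') u))
        \<le> ennreal \<bar>u\<bar> * (\<integral>\<^sup>+\<omega>. ennreal \<bar>S \<omega> - S' \<omega>\<bar> \<partial>M)"
      by (rule cmod_char_diff_le[OF \<open>prob_space M\<close> S_measurable])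
    also have "\<dots> \<le> ennreal \<bar>u\<bar> * (\<integral>\<^sup>+\<omega>. (\<Sum>k<n. ennreal c * ennreal (\<bar>J k \<omega>\<bar> powr r)) \<partial>M)"
      by (intro mult_left_mono nn_integral_mono_AE SS) simp
    also have "\<dots> = ennreal \<bar>u\<bar> * (\<Sum>k<n. ennreal c * (\<integral>\<^sup>+\<omega>. ennreal (\<bar>J k \<omega>\<bar> powr r) \<partial>M))"
      by (simp add: nn_integral_sum nn_integral_cmult)
    also have "\<dots> \<le> ennreal \<bar>u\<bar> * (\<Sum>k<n. ennreal c * ennreal (m * (\<delta> * I)))"
    proof (intro mult_left_mono sum_mono)
      fix k
      show "(\<integral>\<^sup>+\<omega>. ennreal (\<bar>J k \<omega>\<bar> powr r) \<partial>M) \<le> ennreal (m * (\<delta> * I))"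
        unfolding J_def using jump[OF grid(1,2)[of k]] unfolding grid(4) .
    qed auto
    also have "\<dots> = ennreal (\<bar>u\<bar> * (real n * (c * (m * (\<delta> * I)))))"
      using c m d I by (simp add: ennreal_mult[symmetric] ennreal_of_nat_eq_real_of_nat)
    finally have "cmod (?X n - ?A n ^ n) \<le> \<bar>u\<bar> * (real n * (c * (m * (\<delta> * I))))"
      unfolding XA using c m d I by (subst (asm) ennreal_le_iff) auto
    moreover have "\<bar>u\<bar> * (real n * (c * (m * (\<delta> * I)))) = \<bar>u\<bar> * I * (sqrt (real n) * \<delta> powr (1 - r / 2))"
    proof -
      have "real n / sqrt (real n) = sqrt (real n)" using n by (simp add: real_div_sqrt)
      moreover have "\<delta> / \<delta> powr (r / 2) = \<delta> powr (1 - r / 2)" using d by (simp add: powr_diff)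
      moreover have "\<bar>u\<bar> * (real n * (c * (m * (\<delta> * I)))) = \<bar>u\<bar> * I * (real n / sqrt (real n) * (\<delta> / \<delta> powr (r / 2)))"
        using m by (simp add: c_def mult_ac)
      ultimately show ?thesis by simp
    qed
    ultimately show ?thesis unfolding \<delta>_def by linarith
  qed
  have lim0: "(\<lambda>n. \<bar>u\<bar> * I * (sqrt (real n) * \<Delta> n powr (1 - r / 2))) \<longlonglongrightarrow> 0"
    using tendsto_mult_left[OF n\<Delta>r, of "\<bar>u\<bar> * I"] by (simp only: mult_zero_right)
  have ev: "\<forall>\<^sub>F n in sequentially. cmod (?X n - ?A n ^ n) \<le> \<bar>u\<bar> * I * (sqrt (real n) * \<Delta> n powr (1 - r / 2))"
    by (rule eventually_sequentiallyI[of 1], rule bound) simp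
  have "(\<lambda>n. ?X n - ?A n ^ n) \<longlonglongrightarrow> 0" by (rule Lim_null_comparison[OF ev lim0])
  moreover have "(\<lambda>n. ?A n ^ n) \<longlonglongrightarrow> ?l"
    unfolding G_def using \<Delta> \<Delta>0 r n\<Delta> \<sigma> by (rule gaussian_increments_char_tendsto)
  ultimately have "(\<lambda>n. (?X n - ?A n ^ n) + ?A n ^ n) \<longlonglongrightarrow> 0 + ?l" by (rule tendsto_add)
  then show ?thesis by (simp only: diff_add_cancel add_0)
qed

section \<open>The central limit theorem for power variation\<close>

lemma distr_normal_law_scale:
  assumes "0 < v" "0 < D"
  shows "distr (normal_law 0 v) borel (\<lambda>x. D * x) = normal_law 0 (D\<^sup>2 * v)"
  using assms by (simp add: normal_law_eq_distr distr_distr comp_def real_sqrt_mult mult.assoc)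

theorem proposition5p3:
  fixes M :: "'a measure" and L :: "real \<Rightarrow> 'a \<Rightarrow> real"
    and \<Delta> :: "nat \<Rightarrow> real" and r \<sigma> :: real
  assumes "prob_space M"
    and "\<And>n. 0 < n \<Longrightarrow> 0 < \<Delta> n"
    and "\<Delta> \<longlonglongrightarrow> 0"
    and "filterlim (\<lambda>n. real n * \<Delta> n) at_top sequentially"
    and "0 < r" and "r < 1"
    and "(\<lambda>n. real n * \<Delta> n powr (2 - r)) \<longlonglongrightarrow> 0"
    and "0 < \<sigma>"
    and "(\<exists>\<nu>. levy_process_with_density M L \<sigma> \<nu> \<and>
              integrable lborel (\<lambda>x. \<bar>x\<bar> * \<nu> x) \<and>
              integrable lborel (\<lambda>x. \<bar>x\<bar> powr r * \<nu> x))
       \<or> (\<exists>b W B \<Gamma> X \<nu>\<^sub>\<Gamma>.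
              standard_brownian_motion M W \<and> standard_brownian_motion M B \<and>
              subordinator_with_density M \<Gamma> \<nu>\<^sub>\<Gamma> \<and>
              independent_processes3 M W B \<Gamma> \<and>
              integrable M (\<Gamma> 1) \<and>
              set_integrable lborel {0<..} (\<lambda>\<gamma>. \<gamma> * \<nu>\<^sub>\<Gamma> \<gamma>) \<and>
              integral\<^sup>L M (\<Gamma> 1) = (LINT \<gamma>:{0<..}|lborel. \<gamma> * \<nu>\<^sub>\<Gamma> \<gamma>) \<and>
              set_integrable lborel {0<..} (\<lambda>\<gamma>. \<gamma> powr (r / 2) * \<nu>\<^sub>\<Gamma> \<gamma>) \<and>
              real_process M X \<and> (\<forall>t\<ge>0. AE \<omega> in M. X t \<omega> = B (\<Gamma> t \<omega>) \<omega>) \<and>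
              real_process M L \<and> (\<forall>t\<ge>0. AE \<omega> in M. L t \<omega> = b * t + \<sigma> * W t \<omega> + X t \<omega>))"
  shows "weak_conv_m
           (\<lambda>n. distr M borel (\<lambda>\<omega>. sqrt (real n) *
              (power_variation_estimator L (\<Delta> n) r n \<omega> - \<sigma> powr r)))
           (normal_law 0 (\<sigma> powr (2 * r) *
              (gauss_abs_moment (2 * r) / (gauss_abs_moment r)\<^sup>2 - 1)))
       \<and> weak_conv_m
           (\<lambda>n. distr M borel (\<lambda>\<omega>. sqrt (real n) *
              (sigma_estimator L (\<Delta> n) r n \<omega> - \<sigma>)))
           (normal_law 0 (\<sigma>\<^sup>2 / r\<^sup>2 *
              (gauss_abs_moment (2 * r) / (gauss_abs_moment r)\<^sup>2 - 1)))"
proof -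
  interpret prob_space M by fact
  note \<Delta> = assms(2) and r = assms(5,6) and \<sigma> = assms(8)
  define V where "V = \<sigma> powr (2 * r) * (gauss_abs_moment (2 * r) / (gauss_abs_moment r)\<^sup>2 - 1)"
  have V: "0 < V" unfolding V_def using r \<sigma> by (intro centred_power_moments(5)) auto
  have n\<Delta>r: "(\<lambda>n. sqrt (real n) * \<Delta> n powr (1 - r / 2)) \<longlonglongrightarrow> 0"
    using sqrt_times_half_power_tendsto[OF assms(7)] by (simp add: diff_divide_distrib)
  have n\<Delta>: "(\<lambda>n. sqrt (real n) * \<Delta> n) \<longlonglongrightarrow> 0"
  proof -
    have ev: "\<forall>\<^sub>F n in sequentially. 0 \<le> \<Delta> n"
      by (rule eventually_sequentiallyI[of 1]) (use \<Delta> in \<open>auto intro: less_imp_le\<close>)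
    have "(\<lambda>n. \<Delta> n powr (r / 2)) \<longlonglongrightarrow> 0"
      by (rule tendsto_zero_powrI[OF assms(3) tendsto_const]) (use r ev in auto)
    from tendsto_mult[OF n\<Delta>r this]
    have "(\<lambda>n. sqrt (real n) * \<Delta> n powr (1 - r / 2) * \<Delta> n powr (r / 2)) \<longlonglongrightarrow> 0" by simp
    then show ?thesis
    proof (rule Lim_transform_eventually)
      show "\<forall>\<^sub>F n in sequentially. sqrt (real n) * \<Delta> n powr (1 - r / 2) * \<Delta> n powr (r / 2) = sqrt (real n) * \<Delta> n"
      proof (rule eventually_sequentiallyI[of 1])
        fix n :: nat assume "1 \<le> n"
        then have "0 < \<Delta> n" using \<Delta> by simp
        then show "sqrt (real n) * \<Delta> n powr (1 - r / 2) * \<Delta> n powr (r / 2) = sqrt (real n) * \<Delta> n"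
          by (simp add: mult.assoc powr_add[symmetric])
      qed
    qed
  qed
  have r1: "r \<le> 1" using r by simp
  have L: "real_process M L"
    using assms(9) by (auto simp: levy_process_with_density_def levy_process_def)
  have char: "(\<lambda>n. char (distr M borel (\<lambda>\<omega>. sqrt (real n) *
        (power_variation_estimator L (\<Delta> n) r n \<omega> - \<sigma> powr r))) u) \<longlonglongrightarrow> exp (- (V * u\<^sup>2 / 2))" for u
    using assms(9) unfolding V_def
  proof (elim disjE exE conjE, goal_cases)
    case (1 \<nu>)
    show ?case
      by (rule levy_case_char_tendsto[OF \<open>prob_space M\<close> 1 \<Delta> assms(3) r(1) r1 \<sigma> n\<Delta> n\<Delta>r])
  next
    case (2 b W B \<Gamma> X \<nu>)
    show ?case
      by (rule subordinated_case_char_tendsto[OF \<open>prob_space M\<close> 2(1-9) 2(10)[rule_format] 2(11) 2(12)[rule_format]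
          \<Delta> assms(3) r(1) r1 \<sigma> n\<Delta> n\<Delta>r])
  qed
  have rv [measurable]: "power_variation_estimator L (\<Delta> n) r n \<in> borel_measurable M" for n
  proof -
    have m: "(\<lambda>\<omega>. L (real k * \<Delta> n) \<omega> - L ((real k - 1) * \<Delta> n) \<omega>) \<in> borel_measurable M" if "k \<in> {1..n}" for k
    proof -
      have "0 < \<Delta> n" using that \<Delta>[of n] by auto
      then show ?thesis using L that by (auto simp: real_process_def intro!: borel_measurable_diff)
    qed
    have "(\<lambda>x. \<bar>x\<bar> powr r) \<in> borel_measurable borel" by measurable
    then have "(\<lambda>\<omega>. \<Sum>k=1..n. \<bar>L (real k * \<Delta> n) \<omega> - L ((real k - 1) * \<Delta> n) \<omega>\<bar> powr r) \<in> borel_measurable M"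
      by (intro borel_measurable_sum measurable_compose[OF m])
    then show ?thesis unfolding power_variation_estimator_def[abs_def] by measurable
  qed
  have first: "weak_conv_m (\<lambda>n. distr M borel (\<lambda>\<omega>. sqrt (real n) *
      (power_variation_estimator L (\<Delta> n) r n \<omega> - \<sigma> powr r))) (normal_law 0 V)"
  proof (rule levy_continuity)
    show "real_distribution (normal_law 0 V)" using V by (rule real_distribution_normal_law)
    show "(\<lambda>n. char (distr M borel (\<lambda>\<omega>. sqrt (real n) *
      (power_variation_estimator L (\<Delta> n) r n \<omega> - \<sigma> powr r))) u) \<longlonglongrightarrow> char (normal_law 0 V) u" for u
      using char[of u] V by (simp add: char_normal_law)
  qed simp
  define D where "D = 1 / r * (\<sigma> powr r) powr (1 / r - 1)"
  have D: "0 < D" using r \<sigma> by (simp add: D_def)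
  have "((\<lambda>x. x powr (1 / r)) has_real_derivative D) (at (\<sigma> powr r))"
    unfolding D_def using \<sigma> by (intro has_real_derivative_powr) simp
  from delta_method[OF \<open>prob_space M\<close> rv _ this real_distribution_normal_law[OF V] first]
  have "weak_conv_m (\<lambda>n. distr M borel (\<lambda>\<omega>. sqrt (real n) *
      (power_variation_estimator L (\<Delta> n) r n \<omega> powr (1 / r) - (\<sigma> powr r) powr (1 / r))))
      (distr (normal_law 0 V) borel (\<lambda>x. D * x))"
    by measurable
  moreover have "(\<sigma> powr r) powr (1 / r) = \<sigma>" using r \<sigma> by (simp add: powr_powr)
  moreover have "D\<^sup>2 * V = \<sigma>\<^sup>2 / r\<^sup>2 * (gauss_abs_moment (2 * r) / (gauss_abs_moment r)\<^sup>2 - 1)"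
  proof -
    have "D = \<sigma> powr (1 - r) / r" using r by (simp add: D_def powr_powr right_diff_distrib)
    moreover have "(\<sigma> powr (1 - r))\<^sup>2 * \<sigma> powr (2 * r) = \<sigma>\<^sup>2"
      using \<sigma> by (simp add: power2_eq_square powr_add[symmetric])
    ultimately show ?thesis by (simp add: V_def power_divide)
  qed
  ultimately have "weak_conv_m (\<lambda>n. distr M borel (\<lambda>\<omega>. sqrt (real n) * (sigma_estimator L (\<Delta> n) r n \<omega> - \<sigma>)))
      (normal_law 0 (\<sigma>\<^sup>2 / r\<^sup>2 * (gauss_abs_moment (2 * r) / (gauss_abs_moment r)\<^sup>2 - 1)))"
    using distr_normal_law_scale[OF V D] by (simp add: sigma_estimator_def)
  with first show ?thesis unfolding V_def by blast
qed

end
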